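(* Let $\mathbb{F}$ be an arbitrary field and let $s_1(\lambda),\dots,s_m(\lambda)$ be a list of $m$ nonconstant monic polynomials over $\mathbb{F}$ satisfying $s_1(\lambda)\mid s_2(\lambda)\mid\cdots\mid s_m(\lambda)$. Let $\sigma:=\sum_{i=1}^m\deg s_i(\lambda)$, and let $k$ be the maximum degree among all of the $\mathbb{F}$-irreducible factors of the polynomials $s_1,\dots,s_m$. Then for any choice of positive integers $d,n$ such that $n\ge m$ and $dn=\sigma$, there exists an $n\times n$, degree $d$, strictly regular matrix polynomial $Q(\lambda)$ over $\mathbb{F}$ that is $k$-quasi-triangular and has exactly the given polynomials $s_1(\lambda),\dots,s_m(\lambda)$ as its nontrivial invariant polynomials, together with $n-m$ trivial invariant polynomials (equal to $1$). In addition, $Q(\lambda)$ can always be chosen so that the degree of every entry in any off-diagonal block of $Q(\lambda)$ is strictly less than $d$.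
   Context: A matrix polynomial over $\mathbb{F}$ is a matrix with entries in $\mathbb{F}[\lambda]$; its degree is the largest $j$ with nonzero matrix coefficient of $\lambda^j$ (the zero polynomial has degree $-\infty$). The invariant polynomials of an $n\times n$ matrix polynomial $Q$ with nonzero determinant are the monic diagonal entries $q_1\mid q_2\mid\cdots\mid q_n$ of its Smith form $\mathrm{diag}(q_1,\dots,q_n)=U(\lambda)Q(\lambda)V(\lambda)$, where $U,V$ are unimodular (square, with nonzero constant determinant); an invariant polynomial is trivial if it equals $1$. An $n\times n$ matrix polynomial of degree $d$ (with grade taken equal to its degree) is strictly regular if it has no spectral structure at infinity; equivalently, its leading coefficient (the matrix coefficient of $\lambda^d$) is nonsingular. A matrix is $k$-quasi-triangular if it is block upper triangular with square diagonal blocks, each of size at most $k\times k$ (for $k=1$: upper triangular); "off-diagonal block" refers to this block partition. *)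

theory Defs
  imports "Jordan_Normal_Form.Determinant"
begin

text \<open>A matrix polynomial is an element of type \<open>'a poly mat\<close>.\<close>

definition mat_coeff :: "'a::zero poly mat \<Rightarrow> nat \<Rightarrow> 'a mat" where
  "mat_coeff Q j = map_mat (\<lambda>p. coeff p j) Q"

text \<open>The zero matrix polynomial has no degree in the sense of this relation.\<close>

definition has_degree :: "'a::zero poly mat \<Rightarrow> nat \<Rightarrow> bool" where
  "has_degree Q d \<longleftrightarrow>
     mat_coeff Q d \<noteq> 0\<^sub>m (dim_row Q) (dim_col Q) \<and>
     (\<forall>j>d. mat_coeff Q j = 0\<^sub>m (dim_row Q) (dim_col Q))"

definition unimodular :: "nat \<Rightarrow> 'a::field poly mat \<Rightarrow> bool" where
  "unimodular n U \<longleftrightarrow> U \<in> carrier_mat n n \<and> (\<exists>c. c \<noteq> 0 \<and> det U = [:c:])"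

text \<open>
  The list \<open>qs\<close> is the full list \<open>q\<^sub>1, \<dots>, q\<^sub>n\<close>, trivial invariant polynomials included.
  Since the \<open>q\<^sub>i\<close> are monic, such a list exists only if \<open>det Q \<noteq> 0\<close>.
\<close>

definition invariant_polynomials :: "'a::field poly mat \<Rightarrow> 'a poly list \<Rightarrow> bool" where
  "invariant_polynomials Q qs \<longleftrightarrow>
     Q \<in> carrier_mat (length qs) (length qs) \<and>
     (\<forall>q\<in>set qs. lead_coeff q = 1) \<and>
     (\<forall>i. Suc i < length qs \<longrightarrow> qs ! i dvd qs ! Suc i) \<and>
     (\<exists>U V. unimodular (length qs) U \<and> unimodular (length qs) V \<and>
        U * Q * V = mat_diag (length qs) (\<lambda>i. qs ! i))"

text \<open>
  The reversal \<open>\<lambda>\<^sup>g Q(1/\<lambda>)\<close> with respect to the grade \<open>g\<close>, which must be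
  at least the degree of \<open>Q\<close>.
\<close>

definition reversal :: "nat \<Rightarrow> 'a::comm_monoid_add poly mat \<Rightarrow> 'a poly mat" where
  "reversal g Q = map_mat (\<lambda>p. \<Sum>j\<le>g. monom (coeff p j) (g - j)) Q"

text \<open>
  The elementary divisors at infinity of \<open>Q\<close>, taken with grade \<open>g\<close>, are the powers \<open>\<lambda>\<^sup>e\<close>
  with \<open>e > 0\<close> that are the exact powers of \<open>\<lambda>\<close> in the invariant polynomials of the
  reversal; the spectral structure at infinity consists of these.
\<close>

definition elementary_divisor_at_infinity :: "nat \<Rightarrow> 'a::field poly mat \<Rightarrow> nat \<Rightarrow> bool" where
  "elementary_divisor_at_infinity g Q e \<longleftrightarrow>
     e > 0 \<and> (\<exists>qs. invariant_polynomials (reversal g Q) qs \<and> (\<exists>q\<in>set qs. order 0 q = e))"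

text \<open>The grade is taken equal to the degree.\<close>

definition strictly_regular :: "'a::field poly mat \<Rightarrow> bool" where
  "strictly_regular Q \<longleftrightarrow>
     square_mat Q \<and> det Q \<noteq> 0 \<and>
     (\<exists>d. has_degree Q d \<and> \<not> (\<exists>e. elementary_divisor_at_infinity d Q e))"

text \<open>
  A partition of the index set \<open>{0..<n}\<close> into consecutive blocks is given by the list of
  the block sizes; \<open>block_of bs i\<close> is the number of the block containing the index \<open>i\<close>.
\<close>

definition block_partition :: "nat \<Rightarrow> nat list \<Rightarrow> bool" where
  "block_partition n bs \<longleftrightarrow> (\<forall>b\<in>set bs. b > 0) \<and> sum_list bs = n"

definition block_of :: "nat list \<Rightarrow> nat \<Rightarrow> nat" where
  "block_of bs i = (LEAST b. i < sum_list (take (Suc b) bs))"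

definition block_upper_triangular :: "nat list \<Rightarrow> 'a::zero mat \<Rightarrow> bool" where
  "block_upper_triangular bs A \<longleftrightarrow>
     square_mat A \<and> block_partition (dim_row A) bs \<and>
     (\<forall>i<dim_row A. \<forall>j<dim_row A. block_of bs j < block_of bs i \<longrightarrow> A $$ (i, j) = 0)"

text \<open>\<open>k\<close>-quasi-triangular, with \<open>bs\<close> as the witnessing block partition.\<close>

definition quasi_triangular_wrt :: "nat \<Rightarrow> nat list \<Rightarrow> 'a::zero mat \<Rightarrow> bool" where
  "quasi_triangular_wrt k bs A \<longleftrightarrow> block_upper_triangular bs A \<and> (\<forall>b\<in>set bs. b \<le> k)"

definition max_irreducible_factor_degree :: "'a::field poly list \<Rightarrow> nat" where
  "max_irreducible_factor_degree ss =
     Max {degree p | p. irreducible p \<and> (\<exists>s\<in>set ss. p dvd s)}"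

end

theory Submission
  imports Defs
begin

text \<open>
  Start from the diagonal matrix of the prescribed invariant polynomials. Unimodular
  equivalence preserves the invariant polynomials, so it suffices to reach, by such
  equivalences, a block upper triangular matrix with blocks of size at most \<open>k\<close> whose
  coefficient of degree \<open>d\<close> is the identity matrix and whose higher coefficients vanish. Such
  a matrix is strictly regular of degree \<open>d\<close>, and all its off-diagonal entries have degree
  less than \<open>d\<close>.

  The diagonal comes first. On the diagonal of an upper triangular matrix, two adjacent entries
  \<open>a, b\<close> may be replaced by \<open>a', b'\<close> with the same product as soon as every common divisor of
  \<open>a\<close> and \<open>b\<close> divides \<open>a'\<close> and \<open>b'\<close> (\<open>triangular_2x2_change_diagonal\<close>). This permits all
  permutations of the diagonal, and it permits moving a suitable irreducible factor from an entry
  of larger degree to one of smaller degree. The irreducible factors have degree at most \<open>k\<close>,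
  so the moves continue until any two degrees differ by at most \<open>k\<close>
  (\<open>balanced_diagonal_reachable\<close>).

  The deviations of these degrees from \<open>d\<close> then sum to zero and spread over an interval of length
  at most \<open>k\<close>. A pigeonhole argument on partial sums splits them into groups of size at most
  \<open>k\<close>, each with sum zero (\<open>zero_sum_partition\<close>). These groups, placed one after the other
  on the diagonal, are the blocks.

  It remains to turn average degree \<open>d\<close> in each block into degree exactly \<open>d\<close>. Reducing the entries
  modulo the diagonal makes the diagonal degrees the column degrees, with an invertible matrix of
  leading coefficients. Inside a block, one unit of column degree can be shifted from a column of
  larger degree to one of smaller degree (\<open>shift_column_degree\<close>), as in Rosenbrock's theorem.
  Repeating this, all column degrees become \<open>d\<close> (\<open>equalize_column_degrees\<close>), and a final
  multiplication by the inverse of the leading coefficient, which has the same block structure,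
  makes it the identity.
\<close>

section \<open>Unimodular equivalence\<close>

definition unimodularly_equivalent :: "nat \<Rightarrow> 'a::field poly mat \<Rightarrow> 'a poly mat \<Rightarrow> bool" where
  "unimodularly_equivalent n A B \<longleftrightarrow>
     (\<exists>U V. unimodular n U \<and> unimodular n V \<and> B = U * A * V)"

lemma unimodular_carrier: "unimodular n U \<Longrightarrow> U \<in> carrier_mat n n"
  by (simp add: unimodular_def)

lemma unimodular_one: "unimodular n (1\<^sub>m n)"
  unfolding unimodular_def by (auto intro!: exI[of _ 1] simp: one_pCons)

lemma unimodular_mult:
  assumes "unimodular n U" "unimodular n V"
  shows "unimodular n (U * V)"
proof -
  obtain c d where "c \<noteq> 0" "det U = [:c:]" "d \<noteq> 0" "det V = [:d:]"
    and UV: "U \<in> carrier_mat n n" "V \<in> carrier_mat n n"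
    using assms unfolding unimodular_def by blast
  then have "det (U * V) = [:c * d:]" by (simp add: det_mult[OF UV])
  with UV show ?thesis unfolding unimodular_def using \<open>c \<noteq> 0\<close> \<open>d \<noteq> 0\<close> by auto
qed

lemma unimodular_inverse:
  assumes "unimodular n (U :: 'a::field poly mat)"
  obtains W where "unimodular n W" "W * U = 1\<^sub>m n" "U * W = 1\<^sub>m n"
proof -
  obtain c where c: "c \<noteq> 0" "det U = [:c:]" and U: "U \<in> carrier_mat n n"
    using assms unfolding unimodular_def by blast
  define W where "W = [:inverse c:] \<cdot>\<^sub>m adj_mat U"
  note adj = adj_mat[OF U]
  have W: "W \<in> carrier_mat n n" using adj(1) by (simp add: W_def)
  have unit: "[:inverse c:] * [:c:] = (1 :: 'a poly)" using c by (simp add: one_pCons)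
  have one: "[:inverse c:] \<cdot>\<^sub>m ([:c:] \<cdot>\<^sub>m 1\<^sub>m n) = (1\<^sub>m n :: 'a poly mat)"
    using c by (intro eq_matI) (auto simp: one_pCons)
  have "W * U = [:inverse c:] \<cdot>\<^sub>m (adj_mat U * U)"
    unfolding W_def by (rule mult_smult_assoc_mat[OF adj(1) U])
  then have WU: "W * U = 1\<^sub>m n" by (simp only: adj(3) c(2) one)
  have "U * W = [:inverse c:] \<cdot>\<^sub>m (U * adj_mat U)"
    unfolding W_def by (rule mult_smult_distrib[OF U adj(1)])
  then have UW: "U * W = 1\<^sub>m n" by (simp only: adj(2) c(2) one)
  have "det W * [:c:] = 1" using arg_cong[OF WU, of det] by (simp only: det_mult[OF W U] c det_one)
  then have "det W * [:c:] * [:inverse c:] = [:inverse c:]" by (simp only: mult_1_left)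
  moreover have "det W * [:c:] * [:inverse c:] = det W"
    by (simp only: mult.assoc mult.commute[of "[:c:]"] unit mult_1_right)
  ultimately have "det W = [:inverse c:]" by simp
  with W c have "unimodular n W" unfolding unimodular_def by auto
  with WU UW show ?thesis using that by blast
qed

lemma unimodularly_equivalent_refl:
  "A \<in> carrier_mat n n \<Longrightarrow> unimodularly_equivalent n A A"
  unfolding unimodularly_equivalent_def
  by (metis unimodular_one left_mult_one_mat right_mult_one_mat)

lemma unimodularly_equivalent_mult:
  assumes "unimodular n U" "unimodular n V"
  shows "unimodularly_equivalent n A (U * A * V)"
  using assms unfolding unimodularly_equivalent_def by blast

lemma unimodularly_equivalent_left:
  assumes "A \<in> carrier_mat n n" "unimodular n U"
  shows "unimodularly_equivalent n A (U * A)"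
  using unimodularly_equivalent_mult[OF assms(2) unimodular_one, of A] assms
  by (simp add: unimodular_def)

lemma unimodularly_equivalent_right:
  assumes "A \<in> carrier_mat n n" "unimodular n V"
  shows "unimodularly_equivalent n A (A * V)"
  using unimodularly_equivalent_mult[OF unimodular_one assms(2), of A] assms
  by (simp add: unimodular_def)

lemma unimodularly_equivalent_carrier:
  assumes "unimodularly_equivalent n A B" "A \<in> carrier_mat n n"
  shows "B \<in> carrier_mat n n"
  using assms unfolding unimodularly_equivalent_def unimodular_def by auto

lemma unimodularly_equivalent_trans:
  assumes "unimodularly_equivalent n A B" "unimodularly_equivalent n B C" "A \<in> carrier_mat n n"
  shows "unimodularly_equivalent n A C"
proof -
  obtain U V U' V' where u: "unimodular n U" "unimodular n V" "unimodular n U'" "unimodular n V'"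
    and "B = U * A * V" "C = U' * B * V'"
    using assms unfolding unimodularly_equivalent_def by blast
  then have C: "C = U' * (U * A * V) * V'" by simp
  have "C = (U' * U) * A * (V * V')"
    unfolding C using assms(3) u[THEN unimodular_carrier]
    by (simp add: assoc_mult_mat[of _ n n _ n _ n])
  then show ?thesis using unimodular_mult[OF u(3,1)] unimodular_mult[OF u(2,4)]
    unfolding unimodularly_equivalent_def by blast
qed

lemma unimodularly_equivalent_sym:
  assumes "unimodularly_equivalent n A B" "A \<in> carrier_mat n n"
  shows "unimodularly_equivalent n B A"
proof -
  obtain U V where u: "unimodular n U" "unimodular n V" and B: "B = U * A * V"
    using assms unfolding unimodularly_equivalent_def by blast
  obtain U' where U': "unimodular n U'" "U' * U = 1\<^sub>m n" using unimodular_inverse[OF u(1)] by blast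
  obtain V' where V': "unimodular n V'" "V * V' = 1\<^sub>m n" using unimodular_inverse[OF u(2)] by blast
  note c = assms(2) u[THEN unimodular_carrier] U'(1)[THEN unimodular_carrier]
    V'(1)[THEN unimodular_carrier]
  have "U' * B * V' = (U' * U) * A * (V * V')"
    unfolding B using c by (simp add: assoc_mult_mat[of _ n n _ n _ n])
  also have "\<dots> = A" using U'(2) V'(2) assms(2) by simp
  finally show ?thesis using U'(1) V'(1) unfolding unimodularly_equivalent_def by metis
qed

lemma unimodularly_equivalent_det:
  assumes "unimodularly_equivalent n A B" "A \<in> carrier_mat n n"
  obtains c where "c \<noteq> 0" "det B = [:c:] * det A"
proof -
  obtain U V c d where u: "U \<in> carrier_mat n n" "V \<in> carrier_mat n n"
    and cd: "c \<noteq> 0" "d \<noteq> 0" "det U = [:c:]" "det V = [:d:]" and B: "B = U * A * V"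
    using assms unfolding unimodularly_equivalent_def unimodular_def by blast
  have "det B = [:c * d:] * det A"
    unfolding B using u assms(2) cd by (simp add: det_mult[of _ n] mult_ac)
  then show ?thesis using that[of "c * d"] cd by simp
qed

section \<open>Moving factors along the diagonal\<close>

definition mat2 :: "'a \<Rightarrow> 'a \<Rightarrow> 'a \<Rightarrow> 'a \<Rightarrow> 'a mat" where
  "mat2 a b c d = mat 2 2 (\<lambda>(i, j). if i = 0 then if j = 0 then a else b
     else if j = 0 then c else d)"

lemma mat2_carrier [simp]: "mat2 a b c d \<in> carrier_mat 2 2"
  and mat2_index [simp]: "mat2 a b c d $$ (0, 0) = a" "mat2 a b c d $$ (0, Suc 0) = b"
    "mat2 a b c d $$ (Suc 0, 0) = c" "mat2 a b c d $$ (Suc 0, Suc 0) = d"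
  and mat2_dim [simp]: "dim_row (mat2 a b c d) = 2" "dim_col (mat2 a b c d) = 2"
  by (simp_all add: mat2_def)

lemma mat2_eta: "A \<in> carrier_mat 2 2 \<Longrightarrow>
    A = mat2 (A $$ (0,0)) (A $$ (0,1)) (A $$ (1,0)) (A $$ (1,1))"
  by (rule eq_matI) (auto simp: mat2_def less_2_cases_iff)

lemma mat2_mult: "mat2 a b c d * mat2 a' b' c' d' =
    mat2 (a * a' + b * c') (a * b' + b * d') (c * a' + d * c') (c * b' + d * d')"
  for a :: "'a::comm_ring_1"
  by (rule eq_matI)
     (auto simp: mat2_def less_2_cases_iff scalar_prod_def numeral_2_eq_2)

lemma det_mat2: "det (mat2 a b c d) = a * d - b * c" for a :: "'a::comm_ring_1"
proof -
  have s: "det (mat 1 1 f) = f (0, 0)" for f :: "nat \<times> nat \<Rightarrow> 'a"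
    by (subst det_single) auto
  show ?thesis
    by (subst laplace_expansion_row[of _ 2 0])
       (auto simp: numeral_2_eq_2 cofactor_def mat_delete_def s[simplified])
qed

lemma unimodular_mat2:
  assumes "a * d - b * c = [:u:]" "u \<noteq> 0"
  shows "unimodular 2 (mat2 a b c d)"
  using assms unfolding unimodular_def det_mat2 by auto

text \<open>
  Euclid's algorithm, run as a minimality argument: among all nonzero polynomials that
  occur in the upper left corner of an equivalent matrix, take one of least degree. Division
  with remainder followed by a swap would produce a smaller one unless it divides its
  neighbours, so the neighbours can be cleared; adding the second row to the first puts the
  remaining entry next to the corner and shows that the corner divides it as well.
\<close>

lemma smith_form_2x2:
  assumes A: "A \<in> carrier_mat 2 2" and nz: "A $$ (0, 0) \<noteq> (0 :: 'a::field poly)"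
  obtains g h where "unimodularly_equivalent 2 A (mat2 g 0 0 h)" "g dvd h" "g \<noteq> 0"
proof -
  let ?E = "unimodularly_equivalent 2 A"
  let ?P = "\<lambda>x. x \<noteq> 0 \<and> (\<exists>y z w. ?E (mat2 x y z w))"
  have "?P (A $$ (0, 0))"
    using nz mat2_eta[OF A] unimodularly_equivalent_refl[OF A] by metis
  then obtain g where g: "?P g" and min: "\<And>x. ?P x \<Longrightarrow> degree g \<le> degree x"
    using ex_has_least_nat[of ?P "A $$ (0, 0)" degree] by blast
  have E_left: "?E (mat2 p q r s * B)" if "?E B" "p * s - q * r = [:u:]" "u \<noteq> 0" for p q r s B u
    using unimodularly_equivalent_trans[OF that(1) unimodularly_equivalent_left A]
      unimodularly_equivalent_carrier[OF that(1) A] unimodular_mat2[OF that(2,3)] by blast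
  have E_right: "?E (B * mat2 p q r s)" if "?E B" "p * s - q * r = [:u:]" "u \<noteq> 0" for p q r s B u
    using unimodularly_equivalent_trans[OF that(1) unimodularly_equivalent_right A]
      unimodularly_equivalent_carrier[OF that(1) A] unimodular_mat2[OF that(2,3)] by blast
  have small: "r mod g = 0" if "?E (mat2 (r mod g) y z w)" for r y z w
  proof (rule ccontr)
    assume "r mod g \<noteq> 0"
    then have "degree g \<le> degree (r mod g)" using min that by blast
    then show False using degree_mod_less'[of g r] g \<open>r mod g \<noteq> 0\<close> by simp
  qed
  have row: "g dvd y" if "?E (mat2 g y z w)" for y z w
  proof -
    have "?E (mat2 g y z w * mat2 (- (y div g)) 1 1 0)"
      by (rule E_right[OF that, of _ _ _ _ "-1"]) (simp_all add: one_pCons)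
    moreover have "g * - (y div g) + y * 1 = y mod g"
      by (simp add: minus_mult_div_eq_mod [symmetric])
    ultimately have "y mod g = 0" using small[of y] unfolding mat2_mult by metis
    then show ?thesis by (simp add: mod_eq_0_iff_dvd)
  qed
  have col: "g dvd z" if "?E (mat2 g y z w)" for y z w
  proof -
    have "?E (mat2 (- (z div g)) 1 1 0 * mat2 g y z w)"
      by (rule E_left[OF that, of _ _ _ _ "-1"]) (simp_all add: one_pCons)
    moreover have "- (z div g) * g + 1 * z = z mod g"
      by (simp add: minus_mult_div_eq_mod [symmetric] mult.commute)
    ultimately have "z mod g = 0" using small[of z] unfolding mat2_mult by metis
    then show ?thesis by (simp add: mod_eq_0_iff_dvd)
  qed
  obtain y z w where 1: "?E (mat2 g y z w)" using g by blast
  obtain q r where q: "y = g * q" and r: "z = g * r" using row[OF 1] col[OF 1] by (meson dvd_def)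
  have "?E (mat2 1 0 (- r) 1 * mat2 g y z w)"
    by (rule E_left[OF 1, of _ _ _ _ 1]) (simp_all add: one_pCons)
  then have "?E (mat2 1 0 (- r) 1 * mat2 g y z w * mat2 1 (- q) 0 1)"
    by (rule E_right[of _ _ _ _ _ 1]) (simp_all add: one_pCons)
  then obtain h where 2: "?E (mat2 g 0 0 h)"
    by (auto simp: mat2_mult q r mult.commute)
  have "?E (mat2 1 1 0 1 * mat2 g 0 0 h)"
    by (rule E_left[OF 2, of _ _ _ _ 1]) (simp_all add: one_pCons)
  then have "g dvd h" by (auto simp: mat2_mult dest: row)
  with 2 g show ?thesis using that by blast
qed

text \<open>
  The invariant polynomials of a triangular \<open>2 \<times> 2\<close> matrix are the gcd \<open>g\<close> of its entries and
  the quotient of its determinant by \<open>g\<close>. The entry \<open>c\<close> is arbitrary, so all that is known of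
  \<open>g\<close> is that it divides \<open>a\<close> and \<open>b\<close>. If then \<open>g\<close> also divides \<open>a'\<close> and \<open>b'\<close>, the
  matrix with diagonal \<open>a', b'\<close> and \<open>g\<close> in its corner has the same two invariants.
\<close>

lemma triangular_2x2_change_diagonal:
  fixes a b a' b' c :: "'a::field poly"
  assumes nz: "a \<noteq> 0" "b \<noteq> 0" and prod: "a * b = a' * b'"
    and common: "\<And>g. g dvd a \<Longrightarrow> g dvd b \<Longrightarrow> g dvd a' \<and> g dvd b'"
  shows "\<exists>c'. unimodularly_equivalent 2 (mat2 a c 0 b) (mat2 a' c' 0 b')"
proof -
  let ?A = "mat2 a c 0 b"
  obtain g h where E: "unimodularly_equivalent 2 ?A (mat2 g 0 0 h)" and "g dvd h" and g: "g \<noteq> 0"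
    using smith_form_2x2[of ?A] nz by auto
  obtain U V where U: "U \<in> carrier_mat 2 2" and V: "V \<in> carrier_mat 2 2"
    and A: "?A = U * mat2 g 0 0 h * V"
    using unimodularly_equivalent_sym[OF E]
    unfolding unimodularly_equivalent_def unimodular_def by auto
  have entry: "g dvd ?A $$ (i, i)" if "i < 2" for i
    unfolding A using that \<open>g dvd h\<close>
    by (subst mat2_eta[OF U], subst mat2_eta[OF V])
       (auto simp: mat2_mult less_2_cases_iff intro!: dvd_add dvd_mult dvd_mult2)
  have "g dvd a" "g dvd b" using entry[of 0] entry[of 1] by auto
  then obtain x y where x: "a' = g * x" and y: "b' = g * y"
    using common by (meson dvd_def)
  obtain u where u: "u \<noteq> 0" "g * h = [:u:] * (a * b)"
    using unimodularly_equivalent_det[OF E] by (auto simp: det_mat2)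
  then have "g * h = g * ([:u:] * (y * a'))" unfolding prod y by (simp add: mult_ac)
  then have h: "h = [:u:] * (y * a')" using g mult_left_cancel by blast
  have B: "unimodularly_equivalent 2 (mat2 a' g 0 b')
      (mat2 1 0 (- y) 1 * mat2 a' g 0 b' * mat2 0 1 1 (- x))"
    by (intro unimodularly_equivalent_mult unimodular_mat2[of _ _ _ _ 1]
          unimodular_mat2[of _ _ _ _ "-1"]) (simp_all add: one_pCons)
  also have "mat2 1 0 (- y) 1 * mat2 a' g 0 b' * mat2 0 1 1 (- x) = mat2 g 0 0 (- (y * a'))"
    by (simp add: mat2_mult x y algebra_simps)
  finally have B: "unimodularly_equivalent 2 (mat2 g 0 0 (- (y * a'))) (mat2 a' g 0 b')"
    by (rule unimodularly_equivalent_sym) simp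
  have "unimodularly_equivalent 2 (mat2 g 0 0 h) (mat2 g 0 0 h * mat2 1 0 0 [:- inverse u:])"
    using u by (intro unimodularly_equivalent_right unimodular_mat2[of _ _ _ _ "- inverse u"]) auto
  also have "mat2 g 0 0 h * mat2 1 0 0 [:- inverse u:] = mat2 g 0 0 (- (y * a'))"
    using u by (simp add: mat2_mult h)
  finally have "unimodularly_equivalent 2 (mat2 g 0 0 h) (mat2 a' g 0 b')"
    by (rule unimodularly_equivalent_trans[OF _ B]) simp
  then have "unimodularly_equivalent 2 ?A (mat2 a' g 0 b')"
    by (rule unimodularly_equivalent_trans[OF E]) simp
  then show ?thesis ..
qed

text \<open>
  Equivalences of the two diagonal blocks can be carried out side by side; they change the
  corner block but preserve the zero block. This makes local changes of a diagonal possible.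
\<close>

lemma unimodularly_equivalent_four_block:
  fixes A :: "'a::field poly mat"
  assumes EA: "unimodularly_equivalent n A A'" and ED: "unimodularly_equivalent m D D'"
    and A: "A \<in> carrier_mat n n" and B: "B \<in> carrier_mat n m" and D: "D \<in> carrier_mat m m"
  shows "\<exists>B'. B' \<in> carrier_mat n m \<and> unimodularly_equivalent (n + m)
    (four_block_mat A B (0\<^sub>m m n) D) (four_block_mat A' B' (0\<^sub>m m n) D')"
proof -
  obtain U V where u: "unimodular n U" "unimodular n V" and A': "A' = U * A * V"
    using EA unfolding unimodularly_equivalent_def by blast
  obtain X Y where x: "unimodular m X" "unimodular m Y" and D': "D' = X * D * Y"
    using ED unfolding unimodularly_equivalent_def by blast
  note c = u[THEN unimodular_carrier] x[THEN unimodular_carrier]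
  have uni: "unimodular (n + m) (four_block_mat U (0\<^sub>m n m) (0\<^sub>m m n) X)"
    if ux: "unimodular n U" "unimodular m X" for U X :: "'a poly mat"
  proof -
    have "det (four_block_mat U (0\<^sub>m n m) (0\<^sub>m m n) X) = det U * det X"
      using ux by (intro det_four_block_mat_lower_left_zero) (auto simp: unimodular_def)
    moreover obtain c d where "c \<noteq> 0" "det U = [:c:]" "d \<noteq> 0" "det X = [:d:]"
      using ux unfolding unimodular_def by blast
    ultimately have "det (four_block_mat U (0\<^sub>m n m) (0\<^sub>m m n) X) = [:c * d:]" "c * d \<noteq> 0"
      by simp_all
    moreover have "four_block_mat U (0\<^sub>m n m) (0\<^sub>m m n) X \<in> carrier_mat (n + m) (n + m)"
      using ux[THEN unimodular_carrier] by (rule four_block_carrier_mat)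
    ultimately show ?thesis unfolding unimodular_def by (intro conjI exI)
  qed
  let ?B = "U * B * Y"
  have "four_block_mat U (0\<^sub>m n m) (0\<^sub>m m n) X * four_block_mat A B (0\<^sub>m m n) D
      = four_block_mat (U * A + 0\<^sub>m n m * 0\<^sub>m m n) (U * B + 0\<^sub>m n m * D)
          (0\<^sub>m m n * A + X * 0\<^sub>m m n) (0\<^sub>m m n * B + X * D)"
    by (rule mult_four_block_mat[OF c(1) zero_carrier_mat zero_carrier_mat c(3)
          A B zero_carrier_mat D])
  also have "\<dots> = four_block_mat (U * A) (U * B) (0\<^sub>m m n) (X * D)"
    using c A B D by (intro cong_four_block_mat) auto
  finally have "four_block_mat U (0\<^sub>m n m) (0\<^sub>m m n) X * four_block_mat A B (0\<^sub>m m n) D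
      = four_block_mat (U * A) (U * B) (0\<^sub>m m n) (X * D)" .
  moreover have "four_block_mat (U * A) (U * B) (0\<^sub>m m n) (X * D)
      * four_block_mat V (0\<^sub>m n m) (0\<^sub>m m n) Y =
      four_block_mat (U * A * V + U * B * 0\<^sub>m m n) (U * A * 0\<^sub>m n m + U * B * Y)
          (0\<^sub>m m n * V + X * D * 0\<^sub>m m n) (0\<^sub>m m n * 0\<^sub>m n m + X * D * Y)"
    by (rule mult_four_block_mat[OF _ _ zero_carrier_mat _ c(2) zero_carrier_mat
          zero_carrier_mat c(4)])
      (rule mult_carrier_mat[OF c(1) A] mult_carrier_mat[OF c(1) B] mult_carrier_mat[OF c(3) D])+
  moreover have "\<dots> = four_block_mat A' ?B (0\<^sub>m m n) D'"
    unfolding A' D' using c A B D by (intro cong_four_block_mat) auto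
  ultimately have "unimodularly_equivalent (n + m)
    (four_block_mat A B (0\<^sub>m m n) D) (four_block_mat A' ?B (0\<^sub>m m n) D')"
    using unimodularly_equivalent_mult[OF uni[OF u(1) x(1)] uni[OF u(2) x(2)]] by metis
  moreover have "?B \<in> carrier_mat n m" using c B by simp
  ultimately show ?thesis by blast
qed

definition triangular_with_diagonal :: "'a::zero list \<Rightarrow> 'a mat \<Rightarrow> bool" where
  "triangular_with_diagonal ts T \<longleftrightarrow>
     T \<in> carrier_mat (length ts) (length ts) \<and> upper_triangular T \<and> diag_mat T = ts"

lemma triangular_with_diagonal_mat_diag:
  "triangular_with_diagonal qs (mat_diag (length qs) ((!) qs))"
proof -
  have "diag_mat (mat_diag (length qs) ((!) qs)) = qs"
    by (rule nth_equalityI) (simp_all add: mat_diag_def diag_mat_def)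
  then show ?thesis
    by (simp add: triangular_with_diagonal_def upper_triangular_def mat_diag_def)
qed

text \<open>
  The off-diagonal entries of the triangular matrices are deliberately left out of this
  relation: since a step may start from any triangular matrix with the given diagonal,
  steps compose, and a diagonal can be rearranged without tracking the entries above it.
\<close>

definition diagonal_reachable :: "'a::field poly list \<Rightarrow> 'a poly list \<Rightarrow> bool" where
  "diagonal_reachable ts ts' \<longleftrightarrow> (\<forall>T. triangular_with_diagonal ts T \<longrightarrow>
     (\<exists>T'. triangular_with_diagonal ts' T' \<and> unimodularly_equivalent (length ts) T T'))"

lemma diagonal_reachable_length:
  assumes "diagonal_reachable ts ts'"
  shows "length ts' = length ts"
proof -
  obtain T T' where "triangular_with_diagonal ts T" "triangular_with_diagonal ts' T'"
      "unimodularly_equivalent (length ts) T T'"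
    using assms triangular_with_diagonal_mat_diag unfolding diagonal_reachable_def by blast
  moreover from this have "T' \<in> carrier_mat (length ts) (length ts)"
    unfolding triangular_with_diagonal_def by (blast intro: unimodularly_equivalent_carrier)
  ultimately show ?thesis unfolding triangular_with_diagonal_def by auto
qed

lemma diagonal_reachable_refl: "diagonal_reachable ts ts"
  unfolding diagonal_reachable_def triangular_with_diagonal_def
  using unimodularly_equivalent_refl by blast

lemma diagonal_reachable_trans:
  fixes ts us vs :: "'a::field poly list"
  assumes "diagonal_reachable ts us" "diagonal_reachable us vs"
  shows "diagonal_reachable ts vs"
  unfolding diagonal_reachable_def
proof (intro allI impI)
  fix T :: "'a poly mat"
  assume T: "triangular_with_diagonal ts T"
  then obtain T' where T': "triangular_with_diagonal us T'" "unimodularly_equivalent (length ts) T T'"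
    using assms(1) unfolding diagonal_reachable_def by blast
  then obtain T'' where T'': "triangular_with_diagonal vs T''"
      "unimodularly_equivalent (length us) T' T''"
    using assms(2) unfolding diagonal_reachable_def by blast
  have "T \<in> carrier_mat (length ts) (length ts)" using T by (simp add: triangular_with_diagonal_def)
  then have "unimodularly_equivalent (length ts) T T''"
    using unimodularly_equivalent_trans[OF T'(2)] T''(2) diagonal_reachable_length[OF assms(1)]
    by simp
  with T''(1) show "\<exists>T''. triangular_with_diagonal vs T'' \<and>
      unimodularly_equivalent (length ts) T T''" by blast
qed

lemma triangular_with_diagonal_append:
  assumes "triangular_with_diagonal (xs @ ys) T"
  obtains A B D where "triangular_with_diagonal xs A" "triangular_with_diagonal ys D"
    "B \<in> carrier_mat (length xs) (length ys)"
    "T = four_block_mat A B (0\<^sub>m (length ys) (length xs)) D"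
proof -
  let ?n = "length xs" and ?m = "length ys"
  have T: "T \<in> carrier_mat (?n + ?m) (?n + ?m)" "upper_triangular T" "diag_mat T = xs @ ys"
    using assms by (auto simp: triangular_with_diagonal_def)
  obtain A B C D where sp: "split_block T ?n ?n = (A, B, C, D)" by (metis prod_cases4)
  have c: "A \<in> carrier_mat ?n ?n" "B \<in> carrier_mat ?n ?m" "C \<in> carrier_mat ?m ?n"
    "D \<in> carrier_mat ?m ?m" and T_eq: "T = four_block_mat A B C D"
    using split_block[OF sp, of ?m ?m] T(1) by auto
  have entries: "A = mat ?n ?n (\<lambda>ij. T $$ ij)" "C = mat ?m ?n (\<lambda>(i, j). T $$ (i + ?n, j))"
    "D = mat ?m ?m (\<lambda>(i, j). T $$ (i + ?n, j + ?n))"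
    using sp T(1) by (auto simp: split_block_def Let_def)
  have ut: "T $$ (i, j) = 0" if "j < i" "i < ?n + ?m" for i j
    using T(1,2) that by (auto simp: upper_triangular_def)
  have C: "C = 0\<^sub>m ?m ?n" by (rule eq_matI) (auto simp: entries ut)
  have "upper_triangular A" "upper_triangular D"
    by (auto simp: entries upper_triangular_def ut)
  moreover have "diag_mat A = xs \<and> diag_mat D = ys"
    using T(3) c diag_four_block_mat[OF c(1,4), of B C]
    unfolding T_eq by (simp add: diag_mat_def)
  ultimately show ?thesis
    using that[of A D B] c T_eq C by (auto simp: triangular_with_diagonal_def)
qed

lemma diagonal_reachable_append:
  assumes x: "diagonal_reachable xs xs'" and y: "diagonal_reachable ys ys'"
  shows "diagonal_reachable (xs @ ys) (xs' @ ys')"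
  unfolding diagonal_reachable_def
proof (intro allI impI)
  fix T :: "'a poly mat"
  assume "triangular_with_diagonal (xs @ ys) T"
  then obtain A B D where A: "triangular_with_diagonal xs A" and D: "triangular_with_diagonal ys D"
    and B: "B \<in> carrier_mat (length xs) (length ys)"
    and T: "T = four_block_mat A B (0\<^sub>m (length ys) (length xs)) D"
    by (rule triangular_with_diagonal_append)
  obtain A' where A': "triangular_with_diagonal xs' A'" "unimodularly_equivalent (length xs) A A'"
    using x A unfolding diagonal_reachable_def by blast
  obtain D' where D': "triangular_with_diagonal ys' D'" "unimodularly_equivalent (length ys) D D'"
    using y D unfolding diagonal_reachable_def by blast
  obtain B' where B': "B' \<in> carrier_mat (length xs) (length ys)"
    and E: "unimodularly_equivalent (length xs + length ys) T
      (four_block_mat A' B' (0\<^sub>m (length ys) (length xs)) D')"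
    using unimodularly_equivalent_four_block[OF A'(2) D'(2) _ B] A D
    unfolding T triangular_with_diagonal_def by blast
  note len = diagonal_reachable_length[OF x] diagonal_reachable_length[OF y]
  have "triangular_with_diagonal (xs' @ ys')
      (four_block_mat A' B' (0\<^sub>m (length ys) (length xs)) D')"
    using A'(1) D'(1) B' len unfolding triangular_with_diagonal_def
    by (auto simp: diag_four_block_mat[of _ "length xs" _ "length ys"]
        intro!: upper_triangular_four_block)
  with E show "\<exists>T'. triangular_with_diagonal (xs' @ ys') T' \<and>
      unimodularly_equivalent (length (xs @ ys)) T T'"
    by auto
qed

lemma diagonal_reachable_pair:
  fixes a b a' b' :: "'a::field poly"
  assumes "a \<noteq> 0" "b \<noteq> 0" "a * b = a' * b'"
    and "\<And>g. g dvd a \<Longrightarrow> g dvd b \<Longrightarrow> g dvd a' \<and> g dvd b'"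
  shows "diagonal_reachable [a, b] [a', b']"
  unfolding diagonal_reachable_def
proof (intro allI impI)
  have mat2: "triangular_with_diagonal [x, y] (mat2 x z 0 y)" for x y z :: "'a poly"
    by (auto simp: triangular_with_diagonal_def diag_mat_def numeral_2_eq_2 less_Suc_eq)
  fix T :: "'a poly mat"
  assume T: "triangular_with_diagonal [a, b] T"
  then have c: "T \<in> carrier_mat 2 2" by (simp add: triangular_with_diagonal_def numeral_2_eq_2)
  have "T = mat2 a (T $$ (0, 1)) 0 b"
    using T c by (subst mat2_eta[OF c])
      (auto simp: triangular_with_diagonal_def upper_triangular_def diag_mat_def numeral_2_eq_2)
  then show "\<exists>T'. triangular_with_diagonal [a', b'] T' \<and>
      unimodularly_equivalent (length [a, b]) T T'"
    using triangular_2x2_change_diagonal[OF assms, of "T $$ (0, 1)"] mat2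
    by (metis One_nat_def Suc_1 length_Cons list.size(3))
qed

text \<open>
  Two adjacent diagonal entries can always be swapped, since \<open>a, b\<close> and \<open>b, a\<close> have the same
  common divisors; adjacent swaps generate all permutations.
\<close>

lemma diagonal_reachable_mset:
  assumes "mset xs = mset ys" "0 \<notin> set xs"
  shows "diagonal_reachable xs ys"
  using assms
proof (induction xs arbitrary: ys)
  case Nil
  then show ?case by (simp add: diagonal_reachable_refl)
next
  case (Cons x xs)
  obtain us vs where ys: "ys = us @ x # vs"
    using mset_eq_setD[OF Cons.prems(1)] split_list[of x ys] by auto
  have x: "x \<noteq> 0" using Cons.prems(2) by auto
  have bubble: "diagonal_reachable (x # zs @ vs) (zs @ x # vs)" if "0 \<notin> set zs" for zs
    using that
  proof (induction zs)
    case (Cons z zs)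
    have "diagonal_reachable [x, z] [z, x]"
      using x Cons.prems by (intro diagonal_reachable_pair) auto
    from diagonal_reachable_append[OF this diagonal_reachable_refl[of "zs @ vs"]]
    have "diagonal_reachable (x # z # zs @ vs) (z # x # zs @ vs)" by simp
    moreover have "diagonal_reachable (z # x # zs @ vs) (z # zs @ x # vs)"
      using diagonal_reachable_append[OF diagonal_reachable_refl[of "[z]"] Cons.IH] Cons.prems
      by simp
    ultimately show ?case using diagonal_reachable_trans by auto
  qed (simp add: diagonal_reachable_refl)
  have m: "mset xs = mset (us @ vs)" using Cons.prems(1) ys by simp
  then have "diagonal_reachable xs (us @ vs)" using Cons by simp
  from diagonal_reachable_append[OF diagonal_reachable_refl[of "[x]"] this]
  have "diagonal_reachable (x # xs) (x # us @ vs)" by simp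
  moreover have "0 \<notin> set us" using mset_eq_setD[OF m] Cons.prems(2) by auto
  ultimately show ?case using bubble diagonal_reachable_trans ys by blast
qed

section \<open>Balancing the degrees of the diagonal\<close>

lemma bezout_field_poly:
  fixes a b :: "'a::field poly"
  shows "\<exists>g x y. g dvd a \<and> g dvd b \<and> g = x * a + y * b"
proof (induction "if b = 0 then 0 else Suc (degree b)" arbitrary: a b rule: less_induct)
  case less
  show ?case
  proof (cases "b = 0")
    case True
    then show ?thesis by (intro exI[of _ a] exI[of _ 1] exI[of _ 0]) simp
  next
    case False
    have "(if a mod b = 0 then 0 else Suc (degree (a mod b))) < (if b = 0 then 0 else Suc (degree b))"
      using degree_mod_less'[of b a] False by auto
    then obtain g x y where g: "g dvd b" "g dvd a mod b" "g = x * b + y * (a mod b)"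
      using less by blast
    then have "g dvd a" by (metis dvd_mod_iff)
    moreover have "g = y * a + (x - y * (a div b)) * b"
      unfolding g(3) by (simp add: minus_mult_div_eq_mod[symmetric] algebra_simps)
    ultimately show ?thesis using g(1) by blast
  qed
qed

lemma irreducible_divisor_exists:
  fixes a :: "'a::field poly"
  assumes "degree a > 0"
  shows "\<exists>p. irreducible p \<and> p dvd a"
  using assms
proof (induction "degree a" arbitrary: a rule: less_induct)
  case less
  show ?case
  proof (cases "irreducible a")
    case True
    then show ?thesis by (intro exI[of _ a]) simp
  next
    case False
    have "a \<noteq> 0" using less.prems by auto
    then have "\<not> a dvd 1" using less.prems is_unit_iff_degree[of a] by simp
    with \<open>a \<noteq> 0\<close> obtain b c where bc: "a = b * c" "\<not> b dvd 1" "\<not> c dvd 1"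
      using False unfolding irreducible_def by blast
    have nz: "b \<noteq> 0" "c \<noteq> 0" using bc(1) \<open>a \<noteq> 0\<close> by auto
    have pos: "degree b > 0" "degree c > 0"
      using bc(2,3) nz is_unit_iff_degree by blast+
    have "degree a = degree b + degree c" unfolding bc(1) using nz by (rule degree_mult_eq)
    then obtain p where "irreducible p" "p dvd b" using less.hyps[of b] pos by auto
    then show ?thesis using bc(1) by auto
  qed
qed

text \<open>
  Write \<open>a = h * u\<close> with \<open>h\<close> a gcd of \<open>a\<close> and \<open>b\<close>. The degree assumption makes \<open>u\<close>
  nonconstant, and an irreducible factor of \<open>u\<close> can be removed from \<open>a\<close> without losing a common
  divisor of \<open>a\<close> and \<open>b\<close>. Hence this factor may be moved from \<open>a\<close> to \<open>b\<close> on the diagonal of a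
  triangular matrix.
\<close>

lemma exists_transferable_factor:
  fixes a b :: "'a::field poly"
  assumes "b \<noteq> 0" "degree b < degree a"
  obtains p c where "irreducible p" "a = p * c"
    "\<And>g. g dvd a \<Longrightarrow> g dvd b \<Longrightarrow> g dvd c"
proof -
  obtain h x y where h: "h dvd a" "h dvd b" "h = x * a + y * b"
    using bezout_field_poly by blast
  obtain u where u: "a = h * u" using h(1) by blast
  have "a \<noteq> 0" using assms by auto
  then have "h \<noteq> 0" "u \<noteq> 0" using u by auto
  have "degree h \<le> degree b" using h(2) assms(1) by (rule dvd_imp_degree_le)
  then have "degree u > 0" using assms(2) u degree_mult_eq[OF \<open>h \<noteq> 0\<close> \<open>u \<noteq> 0\<close>] by simp
  then obtain p where p: "irreducible p" "p dvd u" using irreducible_divisor_exists by blast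
  then obtain v where "u = p * v" by blast
  then have "a = p * (h * v)" using u by (simp add: mult_ac)
  moreover have "g dvd h * v" if "g dvd a" "g dvd b" for g
    using that unfolding h(3) by (intro dvd_mult2 dvd_add dvd_mult)
  ultimately show ?thesis using that p(1) by blast
qed

text \<open>
  Take a reachable diagonal with the least sum of squared degrees. If two of its degrees
  differed by more than \<open>k\<close>, moving an irreducible factor of degree at most \<open>k\<close> from the larger
  entry to the smaller one would decrease this sum.
\<close>

lemma balanced_diagonal_reachable:
  fixes ts :: "'a::field poly list"
  assumes nz: "0 \<notin> set ts"
    and deg: "\<And>p. irreducible p \<Longrightarrow> p dvd prod_list ts \<Longrightarrow> degree p \<le> k"
  obtains us where "diagonal_reachable ts us" "prod_list us = prod_list ts"
    "\<And>a b. a \<in> set us \<Longrightarrow> b \<in> set us \<Longrightarrow> degree a \<le> degree b + k"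
proof -
  let ?P = "\<lambda>us. diagonal_reachable ts us \<and> prod_list us = prod_list ts"
  let ?f = "\<lambda>us. \<Sum>u\<leftarrow>us. (degree (u :: 'a poly))\<^sup>2"
  have "?P ts" by (simp add: diagonal_reachable_refl)
  then obtain us where us: "?P us" and min: "\<And>vs. ?P vs \<Longrightarrow> ?f us \<le> ?f vs"
    using ex_has_least_nat[of ?P ts ?f] by blast
  have nz': "0 \<notin> set us" using us nz by (metis prod_list_zero_iff)
  have "degree a \<le> degree b + k" if ab: "a \<in> set us" "b \<in> set us" for a b
  proof (rule ccontr)
    assume neg: "\<not> ?thesis"
    then have "a \<noteq> b" by auto
    define M where "M = mset us - {#a#} - {#b#}"
    obtain vs where "mset vs = M" using ex_mset by blast
    moreover have "b \<in># mset us - {#a#}" using ab \<open>a \<noteq> b\<close> by (simp add: in_diff_count)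
    moreover have "mset us = add_mset a (add_mset b M)"
      using calculation ab(1) unfolding M_def by (metis insert_DiffM set_mset_mset)
    ultimately have vs: "mset us = mset (a # b # vs)" by simp
    have abnz: "a \<noteq> 0" "b \<noteq> 0" using ab nz' by auto
    obtain p c where p: "irreducible p" "a = p * c"
      and c: "\<And>g. g dvd a \<Longrightarrow> g dvd b \<Longrightarrow> g dvd c"
      using exists_transferable_factor[of b a] abnz neg by auto
    have pc: "p \<noteq> 0" "c \<noteq> 0" using p abnz by auto
    have prod: "prod_list us = a * b * prod_list vs"
      using arg_cong[OF vs, of prod_mset] by (simp add: prod_mset_prod_list mult_ac)
    have "p dvd prod_list ts" using us prod p(2) by (metis dvd_triv_left mult.assoc)
    then have "degree p \<le> k" using deg p(1) by blast
    have "degree p > 0"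
      using p(1) is_unit_iff_degree[OF pc(1)] by (auto simp: irreducible_def)
    have "diagonal_reachable us (a # b # vs)" using diagonal_reachable_mset[OF vs nz'] .
    moreover have "diagonal_reachable [a, b] [c, p * b]"
      using abnz c by (intro diagonal_reachable_pair) (auto simp: p(2))
    from diagonal_reachable_append[OF this diagonal_reachable_refl[of vs]]
    have "diagonal_reachable (a # b # vs) (c # (p * b) # vs)" by simp
    ultimately have "diagonal_reachable ts (c # (p * b) # vs)"
      using us diagonal_reachable_trans by blast
    moreover have "prod_list (c # (p * b) # vs) = prod_list us"
      by (simp add: prod p(2))
    ultimately have le: "?f us \<le> ?f (c # (p * b) # vs)" using us min by metis
    have "?f us = (degree a)\<^sup>2 + (degree b)\<^sup>2 + ?f vs"
      using arg_cong[OF vs, of "\<lambda>M. \<Sum>u\<in>#M. (degree u)\<^sup>2"]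
      by (simp add: sum_mset_sum_list flip: mset_map)
    moreover have da: "degree a = degree p + degree c" "degree (p * b) = degree p + degree b"
      using pc abnz p(2) by (simp_all add: degree_mult_eq)
    ultimately have "(degree p + degree c)\<^sup>2 + (degree b)\<^sup>2 \<le> (degree c)\<^sup>2 + (degree p + degree b)\<^sup>2"
      using le by simp
    then have le': "degree p * degree c + degree p * degree c \<le> degree p * degree b + degree p * degree b"
      unfolding power2_eq_square distrib_left distrib_right
      by (simp only: mult.commute[of "degree c" "degree p"] mult.commute[of "degree b" "degree p"])
    have "degree c \<le> degree b"
    proof (rule ccontr)
      assume "\<not> ?thesis"
      then have "degree p * degree b < degree p * degree c" using \<open>degree p > 0\<close> by simp
      with le' show False by linarith
    qed
    with neg da \<open>degree p \<le> k\<close> show False by simp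
  qed
  with us that show ?thesis by blast
qed

section \<open>Zero-sum groups\<close>

lemma sum_mset_positive:
  fixes w :: "'b \<Rightarrow> int"
  assumes "N \<noteq> {#}" "\<And>x. x \<in># N \<Longrightarrow> w x > 0"
  shows "(\<Sum>x\<in>#N. w x) > 0"
  using assms
proof (induction N)
  case (add x N)
  then show ?case by (cases "N = {#}") (auto intro: add_pos_pos)
qed simp

lemma sum_mset_negative:
  fixes w :: "'b \<Rightarrow> int"
  assumes "N \<noteq> {#}" "\<And>x. x \<in># N \<Longrightarrow> w x < 0"
  shows "(\<Sum>x\<in>#N. w x) < 0"
  using assms
proof (induction N)
  case (add x N)
  then show ?case by (cases "N = {#}") (auto intro: add_neg_neg)
qed simp

text \<open>
  Fewer than \<open>k\<close> elements can be taken all together. Otherwise list elements one after the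
  other, choosing one of positive weight when the sum so far is at most \<open>0\<close> and one of negative
  weight when it is positive. Since the weights spread over an interval of length at most \<open>k\<close>
  around \<open>0\<close>, all partial sums stay in a window of \<open>k\<close> integers. Two of the first \<open>k + 1\<close> partial
  sums then coincide, and the elements between them have weight zero in total.
\<close>

lemma short_zero_sum_sublist:
  fixes w :: "'b \<Rightarrow> int"
  assumes sum: "(\<Sum>x\<in>#M. w x) = 0" and ne: "M \<noteq> {#}" and k: "k > 0"
    and spread: "\<And>x y. x \<in># M \<Longrightarrow> y \<in># M \<Longrightarrow> w x \<le> w y + int k"
  obtains zs where "zs \<noteq> []" "mset zs \<subseteq># M" "(\<Sum>z\<leftarrow>zs. w z) = 0" "length zs \<le> k"
proof (cases "(\<exists>x\<in>#M. w x = 0) \<or> size M < k")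
  case True
  then show ?thesis
  proof
    assume "\<exists>x\<in>#M. w x = 0"
    then obtain x where "x \<in># M" "w x = 0" by blast
    then show ?thesis using that[of "[x]"] k by simp
  next
    assume "size M < k"
    moreover obtain zs where "mset zs = M" using ex_mset by blast
    ultimately show ?thesis
      using that[of zs] ne sum by (auto simp flip: sum_mset_sum_list)
  qed
next
  case False
  then have nz: "\<And>x. x \<in># M \<Longrightarrow> w x \<noteq> 0" and size: "k \<le> size M" by auto
  obtain x0 where x0: "x0 \<in># M" "\<And>y. y \<in># M \<Longrightarrow> w x0 \<le> w y"
    using Min_in[of "w ` set_mset M"] Min_le[of "w ` set_mset M"] ne by fastforce
  have bounds: "w x0 \<le> w x" "w x \<le> w x0 + int k" if "x \<in># M" for x
    using x0 spread that by auto
  let ?W = "{w x0 + 1..w x0 + int k}"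
  let ?s = "\<lambda>zs. \<Sum>z\<leftarrow>zs. w z"
  \<comment> \<open>What remains to be listed has total weight \<open>- s\<close>, so it contains a weight of the required sign.\<close>
  have opposite: "\<exists>x\<in>#N. (s \<le> 0 \<longrightarrow> w x > 0) \<and> (s > 0 \<longrightarrow> w x < 0)"
    if N: "N \<subseteq># M" "N \<noteq> {#}" "s + (\<Sum>x\<in>#N. w x) = 0" for N s
  proof (rule ccontr)
    assume neg: "\<not> ?thesis"
    have N_M: "\<And>x. x \<in># N \<Longrightarrow> w x \<noteq> 0" using nz N(1) by (meson mset_subset_eqD)
    show False
    proof (cases "s \<le> 0")
      case True
      then have "\<And>y. y \<in># N \<Longrightarrow> w y < 0" using neg N_M by force
      then have "(\<Sum>x\<in>#N. w x) < 0" by (rule sum_mset_negative[OF N(2)])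
      then show False using N(3) True by simp
    next
      case False
      then have "\<And>y. y \<in># N \<Longrightarrow> w y > 0" using neg N_M by force
      then have "(\<Sum>x\<in>#N. w x) > 0" by (rule sum_mset_positive[OF N(2)])
      then show False using N(3) False by simp
    qed
  qed
  have "w x0 < 0 \<and> 0 \<le> w x0 + int k"
  proof -
    obtain y where "y \<in># M" "w y > 0" using opposite[of M 0] ne sum by auto
    moreover have "\<exists>z\<in>#M. w z < 0"
    proof (rule ccontr)
      assume "\<not> ?thesis"
      then have "\<And>x. x \<in># M \<Longrightarrow> w x > 0" using nz by force
      then show False using sum_mset_positive[OF ne, of w] sum by simp
    qed
    then obtain z where "z \<in># M" "w z < 0" by blast
    ultimately show ?thesis using bounds[of y] bounds[of z] by auto
  qed
  then have zero: "0 \<in> ?W" by simp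
  have "\<exists>zs. length zs = j \<and> mset zs \<subseteq># M \<and> (\<forall>i\<le>j. ?s (take i zs) \<in> ?W)" if "j \<le> size M" for j
    using that
  proof (induction j)
    case 0
    then show ?case using zero by simp
  next
    case (Suc j)
    then obtain zs where zs: "length zs = j" "mset zs \<subseteq># M" "\<And>i. i \<le> j \<Longrightarrow> ?s (take i zs) \<in> ?W"
      by auto
    have s: "?s zs \<in> ?W" using zs(3)[of j] zs(1) by simp
    have "M = mset zs + (M - mset zs)" using zs(2) by simp
    then have "?s zs + (\<Sum>x\<in>#(M - mset zs). w x) = 0"
      using sum by (metis image_mset_union mset_map sum_mset.union sum_mset_sum_list)
    moreover have "size (M - mset zs) > 0" using zs(1,2) Suc.prems by (simp add: size_Diff_submset)
    then have "M - mset zs \<noteq> {#}" by (metis less_irrefl size_empty)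
    ultimately obtain x where x: "x \<in># M - mset zs"
        "?s zs \<le> 0 \<longrightarrow> w x > 0" "?s zs > 0 \<longrightarrow> w x < 0"
      using opposite[of "M - mset zs" "?s zs"] by auto
    have "x \<in># M" using x(1) by (rule in_diffD)
    then have "?s (zs @ [x]) \<in> ?W" using s x(2,3) bounds[of x] by auto
    moreover have "mset (zs @ [x]) \<subseteq># M"
    proof -
      have "{#x#} \<subseteq># M - mset zs" using x(1) by simp
      then have "mset zs + {#x#} \<subseteq># mset zs + (M - mset zs)"
        by (rule subset_mset.add_left_mono)
      then show ?thesis using zs(2) by simp
    qed
    ultimately show ?case
      using zs(1,3) by (intro exI[of _ "zs @ [x]"]) (auto simp: le_Suc_eq)
  qed
  then obtain zs where zs: "length zs = k" "mset zs \<subseteq># M" "\<forall>i\<le>k. ?s (take i zs) \<in> ?W"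
    using size by blast
  have "card ((\<lambda>i. ?s (take i zs)) ` {..k}) \<le> card ?W"
    using zs(3) by (intro card_mono) auto
  then have "\<not> inj_on (\<lambda>i. ?s (take i zs)) {..k}"
    by (auto dest!: card_image)
  then obtain i j where ij: "i < j" "j \<le> k" "?s (take i zs) = ?s (take j zs)"
    unfolding inj_on_def by (metis atMost_iff linorder_neqE_nat)
  let ?ys = "drop i (take j zs)"
  have "take i (take j zs) = take i zs" using ij(1) by (simp add: min_def)
  then have split: "take j zs = take i zs @ ?ys"
    using append_take_drop_id[of i "take j zs"] by simp
  have "zs = (take i zs @ ?ys) @ drop j zs"
    by (simp only: split[symmetric] append_take_drop_id)
  from arg_cong[OF this, of mset] have "mset zs = mset ?ys + (mset (take i zs) + mset (drop j zs))"
    by (simp only: mset_append ac_simps)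
  then have "mset ?ys \<subseteq># M" using zs(2) by (metis mset_subset_eq_add_left subset_mset.order_trans)
  moreover have "?s ?ys = 0" using ij(3) arg_cong[OF split, of ?s] by simp
  ultimately show ?thesis using that[of ?ys] ij zs(1) by auto
qed

lemma zero_sum_partition:
  fixes w :: "'b \<Rightarrow> int"
  assumes "(\<Sum>x\<in>#M. w x) = 0" "k > 0"
    and "\<And>x y. x \<in># M \<Longrightarrow> y \<in># M \<Longrightarrow> w x \<le> w y + int k"
  shows "\<exists>gs. mset (concat gs) = M \<and>
    (\<forall>g\<in>set gs. g \<noteq> [] \<and> length g \<le> k \<and> (\<Sum>x\<leftarrow>g. w x) = 0)"
  using assms
proof (induction "size M" arbitrary: M rule: less_induct)
  case less
  show ?case
  proof (cases "M = {#}")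
    case True
    then show ?thesis by (intro exI[of _ "[]"]) simp
  next
    case False
    obtain zs where zs: "zs \<noteq> []" "mset zs \<subseteq># M" "(\<Sum>z\<leftarrow>zs. w z) = 0" "length zs \<le> k"
      using short_zero_sum_sublist[OF less.prems(1) False less.prems(2,3)] by blast
    define N where "N = M - mset zs"
    have M: "M = mset zs + N" using zs(2) by (simp add: N_def)
    have "size N < size M" using zs(1) unfolding M by simp
    moreover have "(\<Sum>x\<in>#N. w x) = 0"
      using less.prems(1) zs(3) unfolding M by (simp add: sum_mset_sum_list flip: mset_map)
    moreover have "w x \<le> w y + int k" if "x \<in># N" "y \<in># N" for x y
      using less.prems(3) that unfolding M by simp
    ultimately obtain gs where gs: "mset (concat gs) = N"
        "\<forall>g\<in>set gs. g \<noteq> [] \<and> length g \<le> k \<and> (\<Sum>x\<leftarrow>g. w x) = 0"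
      using less.hyps[of N] less.prems(2) by blast
    then show ?thesis using zs M by (intro exI[of _ "zs # gs"]) simp
  qed
qed

section \<open>Column degrees and leading coefficients\<close>

lemma index_mult_mat_sum:
  assumes "A \<in> carrier_mat n m" "B \<in> carrier_mat m p" "i < n" "j < p"
  shows "(A * B) $$ (i, j) = (\<Sum>l\<in>{0..<m}. A $$ (i, l) * B $$ (l, j))"
  using assms by (simp add: scalar_prod_def)

lemma coeff_mult_degree_bounds:
  fixes p q :: "'a::comm_semiring_0 poly"
  assumes "degree p \<le> a" "degree q \<le> b"
  shows "coeff (p * q) (a + b) = coeff p a * coeff q b"
proof (cases "degree p = a \<and> degree q = b")
  case True
  then show ?thesis using coeff_mult_degree_sum by blast
next
  case False
  then have "degree p < a \<or> degree q < b" using assms by auto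
  moreover from this have "degree (p * q) < a + b"
    using degree_mult_le[of p q] assms by auto
  ultimately show ?thesis by (auto simp: coeff_eq_0)
qed

lemma coeff_prod_degree_bounds:
  fixes f :: "'b \<Rightarrow> 'a::comm_semiring_1 poly"
  assumes "finite S" "\<And>x. x \<in> S \<Longrightarrow> degree (f x) \<le> b x"
  shows "degree (\<Prod>x\<in>S. f x) \<le> (\<Sum>x\<in>S. b x) \<and>
    coeff (\<Prod>x\<in>S. f x) (\<Sum>x\<in>S. b x) = (\<Prod>x\<in>S. coeff (f x) (b x))"
  using assms
proof (induction S rule: finite_induct)
  case (insert x S)
  then have IH: "degree (\<Prod>x\<in>S. f x) \<le> (\<Sum>x\<in>S. b x)"
    "coeff (\<Prod>x\<in>S. f x) (\<Sum>x\<in>S. b x) = (\<Prod>x\<in>S. coeff (f x) (b x))" by auto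
  have x: "degree (f x) \<le> b x" using insert.prems by simp
  have "degree (f x * (\<Prod>x\<in>S. f x)) \<le> b x + (\<Sum>x\<in>S. b x)"
    using degree_mult_le[of "f x" "\<Prod>x\<in>S. f x"] x IH(1) by linarith
  moreover have "coeff (f x * (\<Prod>x\<in>S. f x)) (b x + (\<Sum>x\<in>S. b x))
      = coeff (f x) (b x) * (\<Prod>x\<in>S. coeff (f x) (b x))"
    using coeff_mult_degree_bounds[OF x IH(1)] IH(2) by simp
  ultimately show ?case using insert.hyps by simp
qed simp

definition column_degrees_le :: "nat \<Rightarrow> 'a::zero poly mat \<Rightarrow> (nat \<Rightarrow> nat) \<Rightarrow> bool" where
  "column_degrees_le n A c \<longleftrightarrow> (\<forall>i<n. \<forall>j<n. degree (A $$ (i, j)) \<le> c j)"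

lemma column_degrees_leD:
  "column_degrees_le n A c \<Longrightarrow> i < n \<Longrightarrow> j < n \<Longrightarrow> degree (A $$ (i, j)) \<le> c j"
  by (simp add: column_degrees_le_def)

definition column_leading_mat :: "nat \<Rightarrow> 'a::zero poly mat \<Rightarrow> (nat \<Rightarrow> nat) \<Rightarrow> 'a mat" where
  "column_leading_mat n A c = mat n n (\<lambda>(i, j). coeff (A $$ (i, j)) (c j))"

lemma column_leading_mat_carrier [simp]: "column_leading_mat n A c \<in> carrier_mat n n"
  by (simp add: column_leading_mat_def)

text \<open>
  Every summand of the Leibniz formula takes one entry from each column, so its degree is at
  most the sum of the column bounds, and its coefficient there is the product of the
  coefficients of the entries at their column bounds.
\<close>

lemma coeff_det_column_degrees:
  fixes A :: "'a::field poly mat"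
  assumes A: "A \<in> carrier_mat n n" and deg: "column_degrees_le n A c"
  shows "coeff (det A) (\<Sum>j\<in>{0..<n}. c j) = det (column_leading_mat n A c)"
proof -
  have term_eq: "coeff (signof p * (\<Prod>i\<in>{0..<n}. A $$ (i, p i))) (\<Sum>j\<in>{0..<n}. c j)
      = signof p * (\<Prod>i\<in>{0..<n}. column_leading_mat n A c $$ (i, p i))"
    if p: "p permutes {0..<n}" for p
  proof -
    have lt: "p i < n" if "i < n" for i using permutes_in_image[OF p, of i] that by simp
    have "(\<Sum>i\<in>{0..<n}. c (p i)) = (\<Sum>j\<in>{0..<n}. c j)"
      using sum.permute[OF p, of c] by (simp add: o_def)
    then have "coeff (\<Prod>i\<in>{0..<n}. A $$ (i, p i)) (\<Sum>j\<in>{0..<n}. c j)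
        = (\<Prod>i\<in>{0..<n}. coeff (A $$ (i, p i)) (c (p i)))"
      using coeff_prod_degree_bounds[of "{0..<n}" "\<lambda>i. A $$ (i, p i)" "\<lambda>i. c (p i)"] deg lt
      by (simp add: column_degrees_le_def)
    also have "\<dots> = (\<Prod>i\<in>{0..<n}. column_leading_mat n A c $$ (i, p i))"
      using lt by (intro prod.cong) (auto simp: column_leading_mat_def)
    finally show ?thesis by (auto simp: sign_def)
  qed
  then show ?thesis
    by (simp add: det_def'[OF A] det_def'[OF column_leading_mat_carrier] coeff_sum)
qed

definition respects_blocks :: "nat \<Rightarrow> (nat \<Rightarrow> nat) \<Rightarrow> 'a::zero mat \<Rightarrow> bool" where
  "respects_blocks n blk A \<longleftrightarrow> (\<forall>i<n. \<forall>j<n. blk j < blk i \<longrightarrow> A $$ (i, j) = 0)"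

lemma respects_blocks_mult:
  fixes A B :: "'a::comm_ring_1 mat"
  assumes "A \<in> carrier_mat n n" "B \<in> carrier_mat n n"
    and "respects_blocks n blk A" "respects_blocks n blk B"
  shows "respects_blocks n blk (A * B)"
  unfolding respects_blocks_def
proof (intro allI impI)
  fix i j
  assume ij: "i < n" "j < n" "blk j < blk i"
  have "A $$ (i, l) * B $$ (l, j) = 0" if "l < n" for l
  proof (cases "blk l < blk i")
    case False
    then have "blk j < blk l" using ij by simp
    then show ?thesis using assms(4) ij that by (simp add: respects_blocks_def)
  qed (use assms(3) ij that in \<open>simp add: respects_blocks_def\<close>)
  then show "(A * B) $$ (i, j) = 0"
    unfolding index_mult_mat_sum[OF assms(1,2) ij(1,2)] by simp
qed

text \<open>
  For an index \<open>r\<close> at which a block begins, write \<open>L\<close> and \<open>M\<close> in \<open>2 \<times> 2\<close> block form with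
  blocks \<open>L1, L2, 0, L4\<close> and \<open>M1, M2, M3, M4\<close>. Then \<open>L * M = 1\<close> gives \<open>L4 * M4 = 1\<close> and
  \<open>L4 * M3 = 0\<close>, so that \<open>L4\<close> is invertible and \<open>M3 = 0\<close>.
\<close>

lemma respects_blocks_inverse:
  fixes L M :: "'a::field mat"
  assumes mono: "\<And>i j. i \<le> j \<Longrightarrow> j < n \<Longrightarrow> blk i \<le> blk j"
    and L: "L \<in> carrier_mat n n" and M: "M \<in> carrier_mat n n"
    and LM: "L * M = 1\<^sub>m n" and resp: "respects_blocks n blk L"
  shows "respects_blocks n blk M"
  unfolding respects_blocks_def
proof (intro allI impI)
  fix i j
  assume ij: "i < n" "j < n" "blk j < blk i"
  define r where "r = (LEAST r. blk i \<le> blk r)"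
  have r_le: "r \<le> i" unfolding r_def by (rule Least_le) simp
  have "blk i \<le> blk r" unfolding r_def by (rule LeastI[of _ i]) simp
  then have ge: "blk i \<le> blk l" if "r \<le> l" "l < n" for l
    using mono[OF that] by simp
  have lt: "blk l < blk i" if "l < r" for l
    using not_less_Least[of l "\<lambda>r. blk i \<le> blk r"] that unfolding r_def by simp
  have "j < r" using ij ge[of j] by (meson not_le)
  have L0: "L $$ (k, l) = 0" if "r \<le> k" "k < n" "l < r" for k l
    using resp that ge[OF that(1,2)] lt[OF that(3)] r_le ij(1)
    unfolding respects_blocks_def by (meson le_less_trans less_le_trans less_trans)
  have lower: "(\<Sum>l\<in>{0..<n - r}. L $$ (k + r, l + r) * M $$ (l + r, q)) = (1\<^sub>m n) $$ (k + r, q)"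
    if k: "k < n - r" and q: "q < n" for k q
  proof -
    have "(1\<^sub>m n) $$ (k + r, q) = (\<Sum>l\<in>{0..<n}. L $$ (k + r, l) * M $$ (l, q))"
      unfolding LM[symmetric] using k q by (intro index_mult_mat_sum[OF L M]) auto
    also have "\<dots> = (\<Sum>l\<in>{0..<r}. L $$ (k + r, l) * M $$ (l, q))
        + (\<Sum>l\<in>{r..<n}. L $$ (k + r, l) * M $$ (l, q))"
      using r_le ij by (intro sum.atLeastLessThan_concat[symmetric]) auto
    also have "(\<Sum>l\<in>{0..<r}. L $$ (k + r, l) * M $$ (l, q)) = 0"
      using k by (intro sum.neutral) (auto simp: L0)
    also have "(\<Sum>l\<in>{r..<n}. L $$ (k + r, l) * M $$ (l, q))
        = (\<Sum>l\<in>{0..<n - r}. L $$ (k + r, l + r) * M $$ (l + r, q))"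
      using sum.shift_bounds_nat_ivl[of "\<lambda>l. L $$ (k + r, l) * M $$ (l, q)" 0 r "n - r"] r_le ij
      by simp
    finally show ?thesis by simp
  qed
  define L4 where "L4 = mat (n - r) (n - r) (\<lambda>(k, l). L $$ (k + r, l + r))"
  define M4 where "M4 = mat (n - r) (n - r) (\<lambda>(k, l). M $$ (k + r, l + r))"
  define M3 where "M3 = mat (n - r) r (\<lambda>(k, l). M $$ (k + r, l))"
  have c: "L4 \<in> carrier_mat (n - r) (n - r)" "M4 \<in> carrier_mat (n - r) (n - r)"
    "M3 \<in> carrier_mat (n - r) r"
    by (simp_all add: L4_def M4_def M3_def)
  have "(L4 * M4) $$ (k, l) = 1\<^sub>m (n - r) $$ (k, l)" if "k < n - r" "l < n - r" for k l
    unfolding index_mult_mat_sum[OF c(1,2) that]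
    using lower[of k "l + r"] that by (simp add: L4_def M4_def)
  then have "L4 * M4 = 1\<^sub>m (n - r)" using c by (intro eq_matI) auto
  then have inv4: "M4 * L4 = 1\<^sub>m (n - r)" by (rule mat_mult_left_right_inverse[OF c(1,2)])
  have "(L4 * M3) $$ (k, l) = 0" if "k < n - r" "l < r" for k l
    unfolding index_mult_mat_sum[OF c(1,3) that]
    using lower[of k l] that r_le ij by (simp add: L4_def M3_def)
  then have "L4 * M3 = 0\<^sub>m (n - r) r" using c by (intro eq_matI) auto
  moreover have "M3 = M4 * (L4 * M3)"
    by (simp only: assoc_mult_mat[OF c(2,1,3), symmetric] inv4 left_mult_one_mat[OF c(3)])
  ultimately have "M3 = 0\<^sub>m (n - r) r" using c(2) by simp
  then have "M3 $$ (i - r, j) = 0" using ij r_le \<open>j < r\<close> by simp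
  then show "M $$ (i, j) = 0" using ij r_le \<open>j < r\<close> by (simp add: M3_def)
qed

text \<open>
  The condition on the determinant says that the matrix of leading column coefficients is
  invertible; multiplying by its inverse from the left, which is a constant and hence
  unimodular operation, turns it into the identity.
\<close>

lemma normalize_leading_mat:
  fixes A :: "'a::field poly mat"
  assumes mono: "\<And>i j. i \<le> j \<Longrightarrow> j < n \<Longrightarrow> blk i \<le> blk j"
    and A: "A \<in> carrier_mat n n" and deg: "column_degrees_le n A c"
    and resp: "respects_blocks n blk A"
    and det: "coeff (det A) (\<Sum>j\<in>{0..<n}. c j) \<noteq> 0"
  obtains B where "unimodularly_equivalent n A B" "column_degrees_le n B c"
    "column_leading_mat n B c = 1\<^sub>m n" "respects_blocks n blk B"
proof -
  define L where "L = column_leading_mat n A c"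
  have L: "L \<in> carrier_mat n n" by (simp add: L_def)
  have dL: "det L \<noteq> 0" using det coeff_det_column_degrees[OF A deg] by (simp add: L_def)
  define M where "M = inverse (det L) \<cdot>\<^sub>m adj_mat L"
  note adj = adj_mat[OF L]
  have M: "M \<in> carrier_mat n n" using adj(1) by (simp add: M_def)
  have "L * M = inverse (det L) \<cdot>\<^sub>m (L * adj_mat L)"
    unfolding M_def by (rule mult_smult_distrib[OF L adj(1)])
  then have LM: "L * M = 1\<^sub>m n" using dL by (auto simp: adj(2) intro!: eq_matI)
  then have M_L: "M * L = 1\<^sub>m n" by (rule mat_mult_left_right_inverse[OF L M])
  have "respects_blocks n blk L"
    using resp by (simp add: L_def column_leading_mat_def respects_blocks_def)
  then have resp_M: "respects_blocks n blk M" using respects_blocks_inverse[of n blk L M] mono L M LM by blast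
  interpret const: comm_ring_hom "\<lambda>a :: 'a. [:a:]"
    by unfold_locales (simp_all add: one_pCons)
  define P where "P = map_mat (\<lambda>a. [:a:]) M"
  have P: "P \<in> carrier_mat n n" using M by (simp add: P_def)
  have "det M \<noteq> 0" using arg_cong[OF M_L, of det] det_mult[OF M L] by auto
  then have uni: "unimodular n P" using P unfolding unimodular_def P_def const.hom_det by blast
  have coeff: "coeff ((P * A) $$ (i, j)) k = (\<Sum>l\<in>{0..<n}. M $$ (i, l) * coeff (A $$ (l, j)) k)"
    if "i < n" "j < n" for i j k
    unfolding index_mult_mat_sum[OF P A that]
    using that M by (simp add: coeff_sum P_def)
  have "column_degrees_le n (P * A) c"
    unfolding column_degrees_le_def
  proof (intro allI impI degree_le)
    fix i j k
    assume ij: "i < n" "j < n" and k: "c j < k"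
    have "coeff (A $$ (l, j)) k = 0" if "l < n" for l
      using column_degrees_leD[OF deg that ij(2)] k by (simp add: coeff_eq_0)
    then show "coeff ((P * A) $$ (i, j)) k = 0" unfolding coeff[OF ij] by simp
  qed
  moreover have "column_leading_mat n (P * A) c $$ (i, j) = (M * L) $$ (i, j)" if "i < n" "j < n" for i j :: nat
    unfolding index_mult_mat_sum[OF M L that]
    using that by (simp add: L_def column_leading_mat_def coeff del: index_mult_mat)
  then have "column_leading_mat n (P * A) c = 1\<^sub>m n"
    unfolding M_L by (intro eq_matI) (auto simp: column_leading_mat_def)
  moreover have "respects_blocks n blk P"
    using resp_M M by (simp add: respects_blocks_def P_def)
  then have "respects_blocks n blk (P * A)" using respects_blocks_mult[OF P A _ resp] by simp
  ultimately show ?thesis using that unimodularly_equivalent_left[OF A uni] by blast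
qed

lemma unimodular_addrow_mat:
  "i \<noteq> j \<Longrightarrow> unimodular n (addrow_mat n a i j :: 'a::field poly mat)"
  unfolding unimodular_def by (auto simp: det_addrow_mat one_pCons)

text \<open>
  With identity leading matrix, adding \<open>x\<close> times row \<open>j\<close> to row \<open>i\<close> raises the degree of
  column \<open>j\<close> by one and turns its leading vector into the unit vector \<open>i\<close>, while the leading
  vector of column \<open>i\<close> remains a multiple of that same vector. A multiple of column \<open>j\<close> by a
  power of \<open>x\<close> therefore cancels the leading term of column \<open>i\<close>. As \<open>i\<close> and \<open>j\<close> belong to
  one block, both operations preserve the block structure.
\<close>

lemma shift_column_degree:
  fixes A :: "'a::field poly mat"
  assumes A: "A \<in> carrier_mat n n" and deg: "column_degrees_le n A c"
    and lead: "column_leading_mat n A c = 1\<^sub>m n" and resp: "respects_blocks n blk A"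
    and ij: "i < n" "j < n" "i \<noteq> j" "blk i = blk j" "c j < c i"
  obtains B where "unimodularly_equivalent n A B"
    "column_degrees_le n B (c(i := c i - 1, j := c j + 1))" "respects_blocks n blk B"
proof -
  have top: "coeff (A $$ (r, l)) (c l) = (if r = l then 1 else 0)" if "r < n" "l < n" for r l
    using arg_cong[OF lead, of "\<lambda>M. M $$ (r, l)"] that by (simp add: column_leading_mat_def)
  have high: "coeff (A $$ (r, l)) k = 0" if "r < n" "l < n" "c l < k" for r l k
    using column_degrees_leD[OF deg that(1,2)] that(3) by (simp add: coeff_eq_0)
  define B1 where "B1 = addrow (monom 1 1) i j A"
  have B1: "B1 \<in> carrier_mat n n" using A by (simp add: B1_def mat_addrow_def)
  have B1_coeff: "coeff (B1 $$ (r, l)) k = coeff (A $$ (r, l)) k +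
      (if r = i \<and> 1 \<le> k then coeff (A $$ (j, l)) (k - 1) else 0)" if "r < n" "l < n" for r l k
    using that A by (simp add: B1_def coeff_monom_mult)
  have E1: "unimodularly_equivalent n A B1"
    unfolding B1_def addrow_mat[OF A ij(2)]
    by (rule unimodularly_equivalent_left[OF A unimodular_addrow_mat[OF ij(3)]])
  define u where "u = 1 + coeff (A $$ (j, i)) (c i - 1)"
  define e where "e = c i - c j - 1"
  define B where "B = addcol (monom (- u) e) i j B1"
  have B: "B \<in> carrier_mat n n" using B1 by (simp add: B_def mat_addcol_def)
  have B_coeff: "coeff (B $$ (r, l)) k = coeff (B1 $$ (r, l)) k -
      (if l = i \<and> e \<le> k then u * coeff (B1 $$ (r, j)) (k - e) else 0)"
    if "r < n" "l < n" for r l k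
    using that B1 ij by (simp add: B_def coeff_monom_mult)
  have "unimodularly_equivalent n B1 B"
    unfolding B_def addcol_mat[OF B1 ij(2)]
    using ij(3) by (intro unimodularly_equivalent_right[OF B1] unimodular_addrow_mat) simp
  then have E: "unimodularly_equivalent n A B" by (rule unimodularly_equivalent_trans[OF E1 _ A])
  have "column_degrees_le n B (c(i := c i - 1, j := c j + 1))"
    unfolding column_degrees_le_def
  proof (intro allI impI degree_le)
    fix r l k
    assume rl: "r < n" "l < n" and k: "(c(i := c i - 1, j := c j + 1)) l < k"
    consider "l = i" | "l = j" | "l \<noteq> i" "l \<noteq> j" by blast
    then show "coeff (B $$ (r, l)) k = 0"
    proof cases
      case 1
      then have k: "c i \<le> k" "c i - 1 < k" using k ij by auto
      \<comment> \<open>In \<open>B1\<close>, the coefficient of column \<open>i\<close> in degree \<open>c i\<close> is \<open>u\<close> times the unit vector \<open>i\<close>,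
        that of column \<open>j\<close> in degree \<open>c j + 1\<close> is the unit vector \<open>i\<close> itself; the shift \<open>e\<close>
        aligns the two degrees.\<close>
      have e: "e \<le> k" "k - e = c j + 1 + (k - c i)" using k(1) ij(5) by (auto simp: e_def)
      have "coeff (B1 $$ (r, i)) k = (if r = i \<and> k = c i then u else 0)"
      proof (cases "k = c i")
        case True
        then show ?thesis using rl ij k by (auto simp: B1_coeff top u_def)
      next
        case False
        then have "c i < k" using k(1) by simp
        moreover have "coeff (A $$ (j, i)) (k - 1) = 0"
        proof (cases "k - 1 = c i")
          case True
          then show ?thesis using top[of j i] ij by simp
        qed (use high[of j i] ij \<open>c i < k\<close> in auto)
        ultimately show ?thesis using rl ij False by (simp add: B1_coeff high)
      qed
      moreover have "coeff (B1 $$ (r, j)) (k - e) = (if r = i \<and> k = c i then 1 else 0)"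
        unfolding e(2) using rl ij k(1) by (auto simp: B1_coeff top high)
      ultimately show ?thesis using rl e(1) 1 by (simp add: B_coeff)
    next
      case 2
      then have "c j < k - 1" "c j < k" "1 \<le> k" using k by auto
      then show ?thesis using rl ij 2 by (simp add: B_coeff B1_coeff high)
    next
      case 3
      then have "c l < k" using k by simp
      moreover have "coeff (A $$ (j, l)) (k - 1) = 0"
      proof (cases "k - 1 = c l")
        case True
        then show ?thesis using top[of j l] ij rl 3 by simp
      qed (use high[of j l] ij rl \<open>c l < k\<close> in auto)
      ultimately show ?thesis using rl ij 3 by (simp add: B_coeff B1_coeff high)
    qed
  qed
  moreover have "respects_blocks n blk B"
    using resp A B1 ij unfolding respects_blocks_def B_def B1_def by auto
  ultimately show ?thesis using that E by blast
qed

lemma sum_fun_upd_pair: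
  fixes f :: "'b \<Rightarrow> 'c \<Rightarrow> nat"
  assumes "finite S" "i \<noteq> j" "i \<in> S" "j \<in> S"
  shows "(\<Sum>l\<in>S. f l ((c(i := x, j := y)) l)) + f i (c i) + f j (c j)
    = (\<Sum>l\<in>S. f l (c l)) + f i x + f j y"
proof -
  have S: "S = insert i (insert j (S - {i, j}))" using assms by blast
  have split: "(\<Sum>l\<in>S. f l (g l)) = f i (g i) + (f j (g j) + (\<Sum>l\<in>S - {i, j}. f l (g l)))" for g
    by (subst S) (use assms in simp)
  have "(\<Sum>l\<in>S - {i, j}. f l ((c(i := x, j := y)) l)) = (\<Sum>l\<in>S - {i, j}. f l (c l))"
    by (intro sum.cong) auto
  then show ?thesis unfolding split using assms(2) by simp
qed

text \<open>
  As long as some column degree differs from \<open>d\<close>, its block contains a degree above \<open>d\<close> and a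
  degree below \<open>d\<close>, and one unit can be shifted from the former to the latter, which decreases
  the sum of the squared degrees. The equality between the degree of the determinant and
  the sum of the column degrees keeps the leading matrix invertible throughout, so that it
  can be normalized before each shift and once more at the end.
\<close>

lemma equalize_column_degrees:
  fixes A :: "'a::field poly mat"
  assumes mono: "\<And>i j. i \<le> j \<Longrightarrow> j < n \<Longrightarrow> blk i \<le> blk j"
    and A: "A \<in> carrier_mat n n" and deg: "column_degrees_le n A c"
    and resp: "respects_blocks n blk A"
    and nz: "det A \<noteq> 0" and deg_det: "degree (det A) = (\<Sum>j\<in>{0..<n}. c j)"
    and block_sum: "\<And>\<beta>. (\<Sum>j | j < n \<and> blk j = \<beta>. c j) = (\<Sum>j | j < n \<and> blk j = \<beta>. d)"
  obtains B where "unimodularly_equivalent n A B" "column_degrees_le n B (\<lambda>_. d)"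
    "column_leading_mat n B (\<lambda>_. d) = 1\<^sub>m n" "respects_blocks n blk B"
proof -
  let ?P = "\<lambda>c. (\<exists>B. unimodularly_equivalent n A B \<and> column_degrees_le n B c \<and>
      respects_blocks n blk B) \<and> (\<Sum>j\<in>{0..<n}. c j) = degree (det A) \<and>
      (\<forall>\<beta>. (\<Sum>j | j < n \<and> blk j = \<beta>. c j) = (\<Sum>j | j < n \<and> blk j = \<beta>. d))"
  let ?f = "\<lambda>c :: nat \<Rightarrow> nat. \<Sum>j\<in>{0..<n}. (c j)\<^sup>2"
  have "?P c" using unimodularly_equivalent_refl[OF A] deg resp deg_det block_sum by auto
  then obtain c' where P: "?P c'" and min: "\<And>c''. ?P c'' \<Longrightarrow> ?f c' \<le> ?f c''"
    using ex_has_least_nat[of ?P c ?f] by blast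
  obtain A' where A': "unimodularly_equivalent n A A'" "column_degrees_le n A' c'"
      "respects_blocks n blk A'"
    using P by blast
  have c: "A' \<in> carrier_mat n n" using unimodularly_equivalent_carrier[OF A'(1) A] .
  obtain u where u: "u \<noteq> 0" "det A' = [:u:] * det A"
    using unimodularly_equivalent_det[OF A'(1) A] by blast
  have "coeff (det A') (\<Sum>j\<in>{0..<n}. c' j) = u * lead_coeff (det A)"
    using P unfolding u(2) by simp
  then have "coeff (det A') (\<Sum>j\<in>{0..<n}. c' j) \<noteq> 0" using u(1) nz by simp
  then obtain B where B: "unimodularly_equivalent n A' B" "column_degrees_le n B c'"
      "column_leading_mat n B c' = 1\<^sub>m n" "respects_blocks n blk B"
    using normalize_leading_mat[OF mono c A'(2,3)] by blast
  have E: "unimodularly_equivalent n A B"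
    by (rule unimodularly_equivalent_trans[OF A'(1) B(1) A])
  have B_c: "B \<in> carrier_mat n n" using unimodularly_equivalent_carrier[OF E A] .
  have all_d: "c' l = d" if l: "l < n" for l
  proof (rule ccontr)
    assume ne: "c' l \<noteq> d"
    let ?S = "{j. j < n \<and> blk j = blk l}"
    have fin: "finite ?S" and lS: "l \<in> ?S" using l by auto
    have eq: "(\<Sum>j\<in>?S. c' j) = (\<Sum>j\<in>?S. d)" using P by blast
    have "\<exists>i\<in>?S. d < c' i"
    proof (rule ccontr)
      assume "\<not> ?thesis"
      then have le: "\<And>j. j \<in> ?S \<Longrightarrow> c' j \<le> d" by force
      then have "c' l < d" using lS ne by force
      then have "(\<Sum>j\<in>?S. c' j) < (\<Sum>j\<in>?S. d)"
        using le lS fin by (intro sum_strict_mono_ex1) auto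
      with eq show False by simp
    qed
    then obtain i where i: "i \<in> ?S" "d < c' i" by blast
    have "\<exists>j\<in>?S. c' j < d"
    proof (rule ccontr)
      assume "\<not> ?thesis"
      then have "\<And>j. j \<in> ?S \<Longrightarrow> d \<le> c' j" by force
      then have "(\<Sum>j\<in>?S. d) < (\<Sum>j\<in>?S. c' j)"
        using i fin by (intro sum_strict_mono_ex1) auto
      with eq show False by simp
    qed
    then obtain j where j: "j \<in> ?S" "c' j < d" by blast
    let ?c = "c'(i := c' i - 1, j := c' j + 1)"
    have ij: "i < n" "j < n" "i \<noteq> j" "blk i = blk j" "c' j < c' i" using i j by auto
    obtain B' where B': "unimodularly_equivalent n B B'" "column_degrees_le n B' ?c"
        "respects_blocks n blk B'"
      using shift_column_degree[OF B_c B(2-4) ij] by blast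
    have same: "(\<Sum>j\<in>S. ?c j) = (\<Sum>j\<in>S. c' j)" if "finite S" "i \<in> S" "j \<in> S" for S
      using sum_fun_upd_pair[OF that(1) ij(3) that(2,3), of "\<lambda>_ x. x" c' "c' i - 1" "c' j + 1"] ij(5)
      by simp
    have "(\<Sum>j\<in>{0..<n}. ?c j) = degree (det A)" using same[of "{0..<n}"] ij P by simp
    moreover have "(\<Sum>j | j < n \<and> blk j = \<beta>. ?c j) = (\<Sum>j | j < n \<and> blk j = \<beta>. d)" for \<beta>
    proof (cases "blk i = \<beta>")
      case True
      then have "(\<Sum>j | j < n \<and> blk j = \<beta>. ?c j) = (\<Sum>j | j < n \<and> blk j = \<beta>. c' j)"
        using ij by (intro same) auto
      then show ?thesis using P by simp
    next
      case False
      then have "(\<Sum>j | j < n \<and> blk j = \<beta>. ?c j) = (\<Sum>j | j < n \<and> blk j = \<beta>. c' j)"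
        using ij by (intro sum.cong) auto
      then show ?thesis using P by simp
    qed
    moreover have "unimodularly_equivalent n A B'"
      by (rule unimodularly_equivalent_trans[OF E B'(1) A])
    ultimately have le: "?f c' \<le> ?f ?c" using B'(2,3) by (intro min) blast
    have "?f ?c + (c' i)\<^sup>2 + (c' j)\<^sup>2 = ?f c' + (c' i - 1)\<^sup>2 + (c' j + 1)\<^sup>2"
      using sum_fun_upd_pair[of "{0..<n}" i j "\<lambda>_ x. x\<^sup>2" c' "c' i - 1" "c' j + 1"] ij by simp
    moreover obtain t where t: "c' i = c' j + 2 + t"
      using i(2) j(2) by (metis Suc_leI add_2_eq_Suc' le_Suc_ex less_trans_Suc)
    have "(c' i - 1)\<^sup>2 + (c' j + 1)\<^sup>2 < (c' i)\<^sup>2 + (c' j)\<^sup>2"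
      unfolding t by (simp add: power2_eq_square algebra_simps)
    ultimately show False using le by linarith
  qed
  have "column_degrees_le n B (\<lambda>_. d)" using B(2) all_d by (simp add: column_degrees_le_def)
  moreover have "column_leading_mat n B (\<lambda>_. d) = column_leading_mat n B c'"
    by (intro eq_matI) (auto simp: column_leading_mat_def all_d)
  ultimately show ?thesis using that E B by simp
qed

section \<open>Reducing a triangular matrix modulo its diagonal\<close>

lemma triangular_with_diagonal_nth:
  assumes "triangular_with_diagonal ts T" "i < length ts"
  shows "T $$ (i, i) = ts ! i"
proof -
  have T: "T \<in> carrier_mat (length ts) (length ts)" and diag: "diag_mat T = ts"
    using assms(1) unfolding triangular_with_diagonal_def by blast+
  have dim: "dim_row T = length ts" by (rule carrier_matD(1)[OF T])
  have "diag_mat T ! i = T $$ (i, i)" using assms(2) by (simp add: diag_mat_def dim)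
  then show ?thesis by (simp only: diag)
qed

text \<open>
  This is the Hermite reduction: the entries above a diagonal entry are replaced by their
  remainders modulo it, column by column from left to right. Subtracting multiples of row
  \<open>J\<close> from the rows above it leaves the earlier columns alone, where row \<open>J\<close> is zero.
\<close>

lemma triangular_column_degrees:
  fixes T :: "'a::field poly mat"
  assumes T: "triangular_with_diagonal ts T" and nz: "0 \<notin> set ts"
  obtains H where "triangular_with_diagonal ts H" "unimodularly_equivalent (length ts) T H"
    "column_degrees_le (length ts) H (\<lambda>j. degree (ts ! j))"
proof -
  let ?n = "length ts"
  have "\<exists>H. triangular_with_diagonal ts H \<and> unimodularly_equivalent ?n T H \<and>
      (\<forall>i<?n. \<forall>j<J. degree (H $$ (i, j)) \<le> degree (ts ! j))" if "J \<le> ?n" for J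
    using that
  proof (induction J)
    case 0
    then show ?case
      using T unimodularly_equivalent_refl by (auto simp: triangular_with_diagonal_def)
  next
    case (Suc J)
    then obtain H where H: "triangular_with_diagonal ts H" "unimodularly_equivalent ?n T H"
      and red: "\<And>i j. i < ?n \<Longrightarrow> j < J \<Longrightarrow> degree (H $$ (i, j)) \<le> degree (ts ! j)"
      by auto
    have J: "J < ?n" using Suc.prems by simp
    have c: "H \<in> carrier_mat ?n ?n" using H(1) by (simp add: triangular_with_diagonal_def)
    have upper: "H $$ (i, j) = 0" if "j < i" "i < ?n" for i j
      using H(1) that by (auto simp: triangular_with_diagonal_def upper_triangular_def)
    define q where "q i = (if i < J then H $$ (i, J) div ts ! J else 0)" for i
    define U where "U = mat ?n ?n (\<lambda>(i, l). (if l = i then 1 else 0) + (if l = J then - q i else 0))"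
    have U: "U \<in> carrier_mat ?n ?n" by (simp add: U_def)
    have "upper_triangular U" by (auto simp: U_def upper_triangular_def q_def)
    moreover have "diag_mat U = map (\<lambda>_. 1) [0..<?n]"
      by (auto simp: diag_mat_def U_def q_def)
    ultimately have "det U = 1" using det_upper_triangular[of U ?n] U by (simp add: map_replicate_const)
    then have uni: "unimodular ?n U" unfolding unimodular_def using U by (auto simp: one_pCons)
    have UH: "(U * H) $$ (i, j) = H $$ (i, j) - q i * H $$ (J, j)" if "i < ?n" "j < ?n" for i j
    proof -
      have "(U * H) $$ (i, j) = (\<Sum>l\<in>{0..<?n}. (if l = i then H $$ (l, j) else 0)
          + (if l = J then - q i * H $$ (l, j) else 0))"
        unfolding index_mult_mat_sum[OF U c that]
        using that by (intro sum.cong) (auto simp: U_def algebra_simps)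
      then show ?thesis using that J by (simp add: sum.distrib)
    qed
    have carrier: "U * H \<in> carrier_mat ?n ?n" using U c by simp
    have "triangular_with_diagonal ts (U * H)"
    proof -
      have "(U * H) $$ (i, j) = 0" if "j < i" "i < ?n" for i j
        using that upper J by (auto simp: UH q_def)
      moreover have "(U * H) $$ (i, i) = ts ! i" if "i < ?n" for i
        using that upper[of i J] J triangular_with_diagonal_nth[OF H(1) that] by (auto simp: UH q_def)
      ultimately show ?thesis using carrier
        unfolding triangular_with_diagonal_def upper_triangular_def diag_mat_def
        by (auto intro!: nth_equalityI simp del: index_mult_mat(1))
    qed
    moreover have "unimodularly_equivalent ?n T (U * H)"
      using unimodularly_equivalent_trans[OF H(2) unimodularly_equivalent_left[OF c uni]] T
      by (simp add: triangular_with_diagonal_def)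
    moreover have "degree ((U * H) $$ (i, j)) \<le> degree (ts ! j)" if "i < ?n" "j < Suc J" for i j
    proof (cases "j = J")
      case True
      consider "i < J" | "i = J" | "J < i" by linarith
      then show ?thesis
      proof cases
        case 1
        then have "(U * H) $$ (i, j) = H $$ (i, J) mod ts ! J"
          using UH[OF that(1), of J] J True triangular_with_diagonal_nth[OF H(1) J]
          by (simp add: q_def minus_div_mult_eq_mod)
        moreover have "ts ! J \<noteq> 0" using nz J by (metis nth_mem)
        ultimately show ?thesis using degree_mod_less[of "ts ! J" "H $$ (i, J)"] True by auto
      next
        case 2
        then show ?thesis
          using UH[OF that(1), of J] J True triangular_with_diagonal_nth[OF H(1) J]
          by (simp add: q_def)
      next
        case 3
        then show ?thesis using UH[OF that(1), of J] J True upper[of J i] that by (simp add: q_def)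
      qed
    next
      case False
      then have "(U * H) $$ (i, j) = H $$ (i, j)" using that J UH[of i j] upper[of j J] by simp
      then show ?thesis using red[of i j] that False by simp
    qed
    ultimately show ?case by blast
  qed
  from this[of ?n] show ?thesis using that unfolding column_degrees_le_def by blast
qed

section \<open>Block partitions\<close>

lemma block_of_Cons:
  assumes "i < sum_list (b # bs)"
  shows "block_of (b # bs) i = (if i < b then 0 else Suc (block_of bs (i - b)))"
proof (cases "i < b")
  case True
  then show ?thesis by (simp add: block_of_def)
next
  case False
  have "(LEAST q. i < sum_list (take (Suc q) (b # bs)))
      = Suc (LEAST q. i < sum_list (take (Suc (Suc q)) (b # bs)))"
    by (rule Least_Suc[of _ "length bs"]) (use assms False in auto)
  also have "(\<lambda>q. i < sum_list (take (Suc (Suc q)) (b # bs)))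
      = (\<lambda>q. i - b < sum_list (take (Suc q) bs))"
    using False by (auto simp: fun_eq_iff)
  finally show ?thesis using False by (simp add: block_of_def)
qed

lemma block_of_mono:
  assumes "i \<le> j" "j < sum_list bs"
  shows "block_of bs i \<le> block_of bs j"
proof -
  have "j < sum_list (take (Suc (block_of bs j)) bs)"
    unfolding block_of_def by (rule LeastI[of _ "length bs"]) (use assms(2) in simp)
  then show ?thesis using assms(1) unfolding block_of_def by (intro Least_le) simp
qed

text \<open>
  The block numbered \<open>\<beta>\<close> of the concatenation of \<open>gs\<close> consists of the positions of the list
  \<open>gs ! \<beta>\<close>, so that sums over a block of indices become sums over one of the lists.
\<close>

lemma sum_over_block:
  fixes f :: "'b \<Rightarrow> nat"
  shows "(\<Sum>j | j < length (concat gs) \<and> block_of (map length gs) j = \<beta>. f (concat gs ! j))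
    = (if \<beta> < length gs then \<Sum>x\<leftarrow>gs ! \<beta>. f x else 0)"
proof (induction gs arbitrary: \<beta>)
  case (Cons g gs)
  let ?N = "length (concat gs)"
  have block: "block_of (map length (g # gs)) j
      = (if j < length g then 0 else Suc (block_of (map length gs) (j - length g)))"
    if "j < length g + ?N" for j
    using that block_of_Cons[of j "length g" "map length gs"] by (simp add: length_concat)
  show ?case
  proof (cases \<beta>)
    case 0
    have "{j. j < length (concat (g # gs)) \<and> block_of (map length (g # gs)) j = \<beta>} = {0..<length g}"
      using block 0 by (auto split: if_splits)
    then show ?thesis using 0 by (simp add: sum_list_sum_nth nth_append)
  next
    case (Suc \<gamma>)
    have "{j. j < length (concat (g # gs)) \<and> block_of (map length (g # gs)) j = \<beta>}
        = (\<lambda>j. j + length g) ` {j. j < ?N \<and> block_of (map length gs) j = \<gamma>}" (is "?A = ?h ` ?B")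
    proof (intro equalityI subsetI)
      fix j assume j: "j \<in> ?A"
      then have "\<not> j < length g" using block[of j] Suc by auto
      then have "j = ?h (j - length g)" "j - length g \<in> ?B" using j block[of j] Suc by auto
      then show "j \<in> ?h ` ?B" by blast
    next
      fix j assume "j \<in> ?h ` ?B"
      then show "j \<in> ?A" using block[of j] Suc by auto
    qed
    moreover have "(\<Sum>j\<in>?h ` ?B. f (concat (g # gs) ! j)) = (\<Sum>j\<in>?B. f (concat gs ! j))"
      by (subst sum.reindex) (auto simp: inj_on_def nth_append)
    ultimately show ?thesis using Cons.IH[of \<gamma>] Suc by simp
  qed
qed simp

section \<open>Monic matrix polynomials\<close>

lemma det_triangular_with_diagonal:
  "triangular_with_diagonal ts T \<Longrightarrow> det T = prod_list ts"
  unfolding triangular_with_diagonal_def using det_upper_triangular by metis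

lemma monic_has_degree:
  fixes Q :: "'a::field poly mat"
  assumes Q: "Q \<in> carrier_mat n n" and n: "n > 0" and deg: "column_degrees_le n Q (\<lambda>_. d)"
    and lead: "column_leading_mat n Q (\<lambda>_. d) = 1\<^sub>m n"
  shows "has_degree Q d"
proof -
  have "mat_coeff Q d = 1\<^sub>m n"
    unfolding lead[symmetric] using Q
    by (intro eq_matI) (auto simp: mat_coeff_def column_leading_mat_def)
  moreover have "1\<^sub>m n \<noteq> (0\<^sub>m n n :: 'a mat)"
  proof
    assume "1\<^sub>m n = (0\<^sub>m n n :: 'a mat)"
    from arg_cong[OF this, of "\<lambda>M. M $$ (0, 0)"] n show False by simp
  qed
  moreover have "mat_coeff Q j = 0\<^sub>m n n" if "d < j" for j
  proof (rule eq_matI)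
    fix r l
    assume "r < dim_row (0\<^sub>m n n :: 'a mat)" "l < dim_col (0\<^sub>m n n :: 'a mat)"
    then have rl: "r < n" "l < n" by simp_all
    then have "coeff (Q $$ (r, l)) j = 0"
      using column_degrees_leD[OF deg rl] that by (simp add: coeff_eq_0)
    then show "mat_coeff Q j $$ (r, l) = 0\<^sub>m n n $$ (r, l)" using rl Q by (simp add: mat_coeff_def)
  qed (use Q in \<open>auto simp: mat_coeff_def\<close>)
  ultimately show ?thesis using Q unfolding has_degree_def by auto
qed

text \<open>
  At \<open>0\<close> the reversal evaluates to the leading coefficient, here the identity matrix. Its
  determinant therefore does not vanish at \<open>0\<close>, and neither does any invariant polynomial,
  since they all divide this determinant up to a constant.
\<close>

lemma monic_no_elementary_divisor_at_infinity:
  fixes Q :: "'a::field poly mat"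
  assumes Q: "Q \<in> carrier_mat n n" and lead: "column_leading_mat n Q (\<lambda>_. d) = 1\<^sub>m n"
  shows "\<not> elementary_divisor_at_infinity d Q e"
proof
  assume "elementary_divisor_at_infinity d Q e"
  then obtain qs q where e: "e > 0" and inv: "invariant_polynomials (reversal d Q) qs"
    and q: "q \<in> set qs" "order 0 q = e"
    unfolding elementary_divisor_at_infinity_def by blast
  let ?R = "reversal d Q"
  have R: "?R \<in> carrier_mat n n" using Q by (simp add: reversal_def)
  have R': "?R \<in> carrier_mat (length qs) (length qs)"
    using inv by (simp add: invariant_polynomials_def)
  obtain U V where "unimodular (length qs) U" "unimodular (length qs) V"
    "U * ?R * V = mat_diag (length qs) ((!) qs)"
    using inv unfolding invariant_polynomials_def by auto
  then have "unimodularly_equivalent (length qs) ?R (mat_diag (length qs) ((!) qs))"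
    unfolding unimodularly_equivalent_def by metis
  then obtain c where c: "c \<noteq> 0" "prod_list qs = [:c:] * det ?R"
    using unimodularly_equivalent_det[OF _ R']
      det_triangular_with_diagonal[OF triangular_with_diagonal_mat_diag[of qs]] by metis
  interpret eval0: comm_ring_hom "\<lambda>p :: 'a poly. poly p 0"
    by unfold_locales simp_all
  have entry: "poly (\<Sum>j\<le>d. monom (coeff p j) (d - j)) 0 = coeff p d" for p :: "'a poly"
  proof -
    have "poly (\<Sum>j\<le>d. monom (coeff p j) (d - j)) 0 = (\<Sum>j\<le>d. if j = d then coeff p j else 0)"
      unfolding poly_sum by (intro sum.cong) (auto simp: poly_monom)
    then show ?thesis by simp
  qed
  have "map_mat (\<lambda>p. poly p 0) ?R = 1\<^sub>m n"
    unfolding lead[symmetric] using Q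
    by (intro eq_matI) (auto simp: reversal_def column_leading_mat_def entry)
  then have "poly (det ?R) 0 = 1" by (simp flip: eval0.hom_det)
  then have "poly (prod_list qs) 0 \<noteq> 0" using c by simp
  moreover have "q dvd prod_list qs" using q(1) by (rule prod_list_dvd)
  ultimately have "poly q 0 \<noteq> 0" by auto
  then show False using order_0I q(2) e by fastforce
qed

section \<open>The realization theorem\<close>

lemma degree_prod_list_field:
  fixes xs :: "'a::field poly list"
  shows "0 \<notin> set xs \<Longrightarrow> degree (prod_list xs) = (\<Sum>x\<leftarrow>xs. degree x)"
  by (induction xs) (auto simp: degree_mult_eq)

lemma irreducible_dvd_prod_list:
  fixes p :: "'a::field poly"
  assumes p: "irreducible p"
  shows "p dvd prod_list xs \<Longrightarrow> \<exists>x\<in>set xs. p dvd x"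
proof (induction xs)
  case Nil
  then show ?case using p by (simp add: irreducible_def)
next
  case (Cons x xs)
  then have "p dvd x \<or> p dvd prod_list xs"
    using prime_elem_dvd_multD[OF field_poly_irreducible_imp_prime[OF p]] by simp
  then show ?case using Cons.IH by auto
qed

lemma degree_le_max_irreducible_factor_degree:
  fixes ss :: "'a::field poly list"
  assumes "0 \<notin> set ss" "irreducible p" "s \<in> set ss" "p dvd s"
  shows "degree p \<le> max_irreducible_factor_degree ss"
proof -
  have "{degree p | p. irreducible p \<and> (\<exists>s\<in>set ss. p dvd s)} \<subseteq> (\<Union>s\<in>set ss. {..degree s})"
  proof
    fix x
    assume "x \<in> {degree p | p. irreducible p \<and> (\<exists>s\<in>set ss. p dvd s)}"
    then obtain r t where "x = degree r" "t \<in> set ss" "r dvd t" by blast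
    moreover have "t \<noteq> 0" using assms(1) \<open>t \<in> set ss\<close> by blast
    ultimately have "t \<in> set ss" "x \<le> degree t" using dvd_imp_degree_le by blast+
    then show "x \<in> (\<Union>s\<in>set ss. {..degree s})" by blast
  qed
  then have "finite {degree p | p. irreducible p \<and> (\<exists>s\<in>set ss. p dvd s)}"
    by (rule finite_subset) simp
  then show ?thesis unfolding max_irreducible_factor_degree_def
    using assms(2-4) by (intro Max_ge) auto
qed

text \<open>
  The deviations of the diagonal degrees from \<open>d\<close> add up to zero, and after balancing they
  differ by at most \<open>k\<close>. Hence the diagonal can be permuted into groups of at most \<open>k\<close> entries
  whose average degree is exactly \<open>d\<close>.
\<close>

lemma zero_sum_diagonal_reachable:
  fixes qs :: "'a::field poly list"
  assumes nz: "0 \<notin> set qs" and k: "k > 0"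
    and factors: "\<And>p. irreducible p \<Longrightarrow> p dvd prod_list qs \<Longrightarrow> degree p \<le> k"
    and deg: "degree (prod_list qs) = d * length qs"
  obtains gs where "diagonal_reachable qs (concat gs)" "0 \<notin> set (concat gs)"
    "\<And>g. g \<in> set gs \<Longrightarrow> g \<noteq> [] \<and> length g \<le> k \<and> (\<Sum>t\<leftarrow>g. degree t) = d * length g"
proof -
  obtain us where us: "diagonal_reachable qs us" "prod_list us = prod_list qs"
      "\<And>a b. a \<in> set us \<Longrightarrow> b \<in> set us \<Longrightarrow> degree a \<le> degree b + k"
    using balanced_diagonal_reachable[OF nz factors] by blast
  have nz': "0 \<notin> set us" using us(2) nz by (metis prod_list_zero_iff)
  let ?w = "\<lambda>u :: 'a poly. int (degree u) - int d"
  have w: "(\<Sum>u\<leftarrow>g. ?w u) = int (\<Sum>u\<leftarrow>g. degree u) - int (d * length g)" for g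
    by (induction g) (simp_all add: algebra_simps)
  have "(\<Sum>u\<leftarrow>us. degree u) = d * length us"
    using degree_prod_list_field[OF nz'] us(2) deg diagonal_reachable_length[OF us(1)] by simp
  then have "(\<Sum>u\<in>#mset us. ?w u) = 0" using w[of us] by (simp add: sum_mset_sum_list flip: mset_map)
  then obtain gs where gs: "mset (concat gs) = mset us"
      "\<forall>g\<in>set gs. g \<noteq> [] \<and> length g \<le> k \<and> (\<Sum>u\<leftarrow>g. ?w u) = 0"
    using zero_sum_partition[of ?w "mset us" k] k us(3) by fastforce
  have "diagonal_reachable qs (concat gs)"
    using diagonal_reachable_trans[OF us(1) diagonal_reachable_mset[OF gs(1)[symmetric] nz']] .
  moreover have "0 \<notin> set (concat gs)" using mset_eq_setD[OF gs(1)] nz' by simp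
  moreover have "g \<noteq> [] \<and> length g \<le> k \<and> (\<Sum>t\<leftarrow>g. degree t) = d * length g" if "g \<in> set gs" for g
    using gs(2) that unfolding w by (auto simp flip: of_nat_mult)
  ultimately show ?thesis using that by blast
qed

lemma monic_block_triangular_realization:
  fixes qs :: "'a::field poly list"
  assumes nz: "0 \<notin> set qs" and k: "k > 0"
    and factors: "\<And>p. irreducible p \<Longrightarrow> p dvd prod_list qs \<Longrightarrow> degree p \<le> k"
    and deg: "degree (prod_list qs) = d * length qs"
  obtains Q bs where
    "unimodularly_equivalent (length qs) (mat_diag (length qs) ((!) qs)) Q"
    "column_degrees_le (length qs) Q (\<lambda>_. d)"
    "column_leading_mat (length qs) Q (\<lambda>_. d) = 1\<^sub>m (length qs)"
    "block_partition (length qs) bs" "\<forall>b\<in>set bs. b \<le> k"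
    "respects_blocks (length qs) (block_of bs) Q"
proof -
  let ?n = "length qs" and ?D = "mat_diag (length qs) ((!) qs)"
  obtain gs where reach: "diagonal_reachable qs (concat gs)" and nz': "0 \<notin> set (concat gs)"
    and gs: "\<And>g. g \<in> set gs \<Longrightarrow> g \<noteq> [] \<and> length g \<le> k \<and> (\<Sum>t\<leftarrow>g. degree t) = d * length g"
    using zero_sum_diagonal_reachable[OF nz k factors deg] by blast
  define ts where "ts = concat gs"
  define bs where "bs = map length gs"
  have len: "length ts = ?n" using diagonal_reachable_length[OF reach] by (simp add: ts_def)
  have sum_bs: "sum_list bs = ?n" using len by (simp add: bs_def ts_def length_concat)
  have part: "block_partition ?n bs" "\<forall>b\<in>set bs. b \<le> k"
    using gs sum_bs by (auto simp: block_partition_def bs_def)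
  have D: "?D \<in> carrier_mat ?n ?n" by simp
  obtain T where T: "triangular_with_diagonal ts T" "unimodularly_equivalent ?n ?D T"
    using reach triangular_with_diagonal_mat_diag unfolding diagonal_reachable_def ts_def by blast
  obtain H where H: "triangular_with_diagonal ts H" "unimodularly_equivalent ?n T H"
      "column_degrees_le ?n H (\<lambda>j. degree (ts ! j))"
    using triangular_column_degrees[OF T(1)] nz' len unfolding ts_def by metis
  have EH: "unimodularly_equivalent ?n ?D H" by (rule unimodularly_equivalent_trans[OF T(2) H(2) D])
  have H_c: "H \<in> carrier_mat ?n ?n" by (rule unimodularly_equivalent_carrier[OF EH D])
  have mono: "\<And>i j. i \<le> j \<Longrightarrow> j < ?n \<Longrightarrow> block_of bs i \<le> block_of bs j"
    using block_of_mono sum_bs by simp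
  have resp: "respects_blocks ?n (block_of bs) H"
    unfolding respects_blocks_def
  proof (intro allI impI)
    fix i j
    assume ij: "i < ?n" "j < ?n" "block_of bs j < block_of bs i"
    then have "j < i" using mono[of i j] by (meson not_le)
    then show "H $$ (i, j) = 0"
      using H(1) H_c ij(1) by (auto simp: triangular_with_diagonal_def upper_triangular_def)
  qed
  have det_H: "det H = prod_list ts" by (rule det_triangular_with_diagonal[OF H(1)])
  have "det H \<noteq> 0" unfolding det_H using nz' by (simp add: ts_def prod_list_zero_iff)
  moreover have "degree (det H) = (\<Sum>j\<in>{0..<?n}. degree (ts ! j))"
    unfolding det_H using degree_prod_list_field[of ts] nz' len
    by (simp add: ts_def sum_list_sum_nth)
  moreover have "(\<Sum>j | j < ?n \<and> block_of bs j = \<beta>. degree (ts ! j))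
      = (\<Sum>j | j < ?n \<and> block_of bs j = \<beta>. d)" for \<beta>
    using sum_over_block[of degree gs \<beta>] sum_over_block[of "\<lambda>_. d" gs \<beta>] gs[of "gs ! \<beta>"] len
    by (simp add: ts_def bs_def sum_list_triv mult.commute split: if_splits)
  ultimately obtain Q where Q: "unimodularly_equivalent ?n H Q" "column_degrees_le ?n Q (\<lambda>_. d)"
      "column_leading_mat ?n Q (\<lambda>_. d) = 1\<^sub>m ?n" "respects_blocks ?n (block_of bs) Q"
    using equalize_column_degrees[OF mono H_c H(3) resp] by blast
  have "unimodularly_equivalent ?n ?D Q" by (rule unimodularly_equivalent_trans[OF EH Q(1) D])
  then show ?thesis using that Q part by blast
qed

theorem theorem3p1:
  fixes ss :: "'a::field poly list" and m k d n :: nat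
  assumes "length ss = m"
    and "\<forall>s\<in>set ss. degree s > 0 \<and> lead_coeff s = 1"
    and "\<forall>i. Suc i < m \<longrightarrow> ss ! i dvd ss ! Suc i"
    and "k = max_irreducible_factor_degree ss"
    and "d > 0" and "n > 0" and "n \<ge> m"
    and "d * n = (\<Sum>s\<leftarrow>ss. degree s)"
  shows "\<exists>Q bs. Q \<in> carrier_mat n n \<and> has_degree Q d \<and> strictly_regular Q \<and>
    quasi_triangular_wrt k bs Q \<and>
    invariant_polynomials Q (replicate (n - m) 1 @ ss) \<and>
    (\<forall>i<n. \<forall>j<n. block_of bs i \<noteq> block_of bs j \<longrightarrow> degree (Q $$ (i, j)) < d)"
proof -
  define qs where "qs = replicate (n - m) 1 @ ss"
  have len: "length qs = n" using assms(1,7) by (simp add: qs_def)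
  have nz_ss: "0 \<notin> set ss" using assms(2) by auto
  have nz: "0 \<notin> set qs" using nz_ss by (auto simp: qs_def)
  have prod: "prod_list qs = prod_list ss" by (simp add: qs_def)
  have deg: "degree (prod_list qs) = d * length qs"
    unfolding prod len using degree_prod_list_field[OF nz_ss] assms(8) by simp
  have factors: "degree p \<le> k" if "irreducible p" "p dvd prod_list qs" for p
    using irreducible_dvd_prod_list[OF that(1)] that
      degree_le_max_irreducible_factor_degree[OF nz_ss that(1)] assms(4) unfolding prod by blast
  have k: "k > 0"
  proof -
    have "degree (prod_list qs) > 0" using deg len assms(5,6) by simp
    then obtain p where p: "irreducible p" "p dvd prod_list qs"
      using irreducible_divisor_exists by blast
    then have "p \<noteq> 0" "\<not> is_unit p" by (auto simp: irreducible_def)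
    then have "degree p > 0" using is_unit_iff_degree[of p] by simp
    then show ?thesis using factors[OF p] by simp
  qed
  let ?D = "mat_diag n ((!) qs)"
  have D: "?D \<in> carrier_mat n n" by simp
  obtain Q bs where E: "unimodularly_equivalent n ?D Q"
    and Qdeg: "column_degrees_le n Q (\<lambda>_. d)"
    and lead: "column_leading_mat n Q (\<lambda>_. d) = 1\<^sub>m n"
    and bs: "block_partition n bs" "\<forall>b\<in>set bs. b \<le> k"
    and resp: "respects_blocks n (block_of bs) Q"
    using monic_block_triangular_realization[OF nz k factors deg] unfolding len by blast
  have Q: "Q \<in> carrier_mat n n" by (rule unimodularly_equivalent_carrier[OF E D])
  have has_deg: "has_degree Q d" by (rule monic_has_degree[OF Q assms(6) Qdeg lead])
  have "det ?D = prod_list qs"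
    using det_triangular_with_diagonal[OF triangular_with_diagonal_mat_diag[of qs]] len by simp
  moreover have "prod_list qs \<noteq> 0" using nz by (simp add: prod_list_zero_iff)
  moreover obtain c where "c \<noteq> 0" "det Q = [:c:] * det ?D"
    using unimodularly_equivalent_det[OF E D] by blast
  ultimately have "det Q \<noteq> 0" by simp
  then have "strictly_regular Q"
    using has_deg monic_no_elementary_divisor_at_infinity[OF Q lead] Q
    unfolding strictly_regular_def by auto
  moreover have "quasi_triangular_wrt k bs Q"
    using bs resp Q
    by (auto simp: quasi_triangular_wrt_def block_upper_triangular_def respects_blocks_def)
  moreover have "invariant_polynomials Q qs"
  proof -
    have "\<forall>q\<in>set qs. lead_coeff q = 1" using assms(2) by (auto simp: qs_def)
    moreover have "qs ! i dvd qs ! Suc i" if "Suc i < length qs" for i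
    proof (cases "i < n - m")
      case True
      then show ?thesis by (simp add: qs_def nth_append)
    next
      case False
      then have "Suc (i - (n - m)) < m" "Suc i - (n - m) = Suc (i - (n - m))"
        using that assms(7) by (simp_all add: len)
      then show ?thesis using assms(3) False by (simp add: qs_def nth_append)
    qed
    moreover have "\<exists>U V. unimodular n U \<and> unimodular n V \<and> U * Q * V = ?D"
      using unimodularly_equivalent_sym[OF E D] unfolding unimodularly_equivalent_def by metis
    ultimately show ?thesis using Q unfolding invariant_polynomials_def len by auto
  qed
  moreover have "degree (Q $$ (i, j)) < d"
    if "i < n" "j < n" "block_of bs i \<noteq> block_of bs j" for i j
  proof -
    have "coeff (Q $$ (i, j)) d = 0"
      using arg_cong[OF lead, of "\<lambda>M. M $$ (i, j)"] that
      by (auto simp: column_leading_mat_def split: if_splits)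
    moreover have "degree (Q $$ (i, j)) \<le> d" by (rule column_degrees_leD[OF Qdeg that(1,2)])
    ultimately show ?thesis using assms(5)
      by (metis degree_0 leading_coeff_0_iff le_neq_implies_less)
  qed
  ultimately show ?thesis using Q has_deg unfolding qs_def by blast
qed

end
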